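(* The system CF is complete for affine retractions: for all simple types $\rho$ and $\tau$, if $\rho\trianglelefteq^1\tau$ holds (i.e. $\rho$ is a retract of $\tau$ via an affine coder and an affine decoder), then the statement $\rho\trianglelefteq^1\tau$ is derivable in the system CF.
   Context: Simple types are built from type variables (atoms) $a,b,c,\dots$ (many distinct atoms) with $\to$. Terms are simply typed $\lambda$-terms in Church style. Retraction: $\rho\trianglelefteq\tau$ means that there are a type environment $E$ and terms $C$ (the coder), $D$ (the decoder) with $E,(x:\rho)\vdash C:\tau$, $E\vdash D:\tau\to\rho$, $x\notin FV(D)$, and $DC=_{\beta\eta}x$. The types of the free variables declared in $E$ are arbitrary. A $\lambda$-term is affine (a BCK-term) if each variable occurs in it at most once. $\rho\trianglelefteq^1\tau$ means that $\rho\trianglelefteq\tau$ holds with an affine coder $C$ and an affine decoder $D$. Isomorphism convention: $\sim$ is the least equivalence relation on simple types such that (1) $\tau\sim\tau'$ and $\sigma\sim\sigma'$ imply $(\tau\to\sigma)\sim(\tau'\to\sigma')$, and (2) $(\tau\to\sigma\to\rho)\sim(\sigma\to\tau\to\rho)$. Types related by $\sim$ are identified, in particular in derivations. For a finite multiset of types $\Sigma=\{\tau_1,\dots,\tau_k\}$, $\Sigma\to\rho$ denotes (any representative of the $\sim$-class of) $\tau_1\to\cdots\to\tau_k\to\rho$ (just $\rho$ if $\Sigma$ is empty). System CF derives statements of the form $\rho\trianglelefteq^1\tau$ (types modulo $\sim$) from: (Axiom) $a\trianglelefteq^1 a$, for each atom $a$. (H) from $\sigma\trianglelefteq^1\sigma'$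 and $\tau\trianglelefteq^1\tau'$ infer $\sigma\to\tau\trianglelefteq^1\sigma'\to\tau'$. (N) from $\rho\trianglelefteq^1\tau$ infer $\rho\trianglelefteq^1\Sigma\to\tau$. (D) from $\Delta_1\to a\trianglelefteq^1\sigma_1,\ \dots,\ \Delta_n\to a\trianglelefteq^1\sigma_n$ infer $\Delta_1\cup\dots\cup\Delta_n\to a\ \trianglelefteq^1\ \{\Sigma_1\to\sigma_1\to a,\dots,\Sigma_n\to\sigma_n\to a\}\to a$. Here $\Sigma,\Sigma_i,\Delta_i$ are arbitrary finite multisets of types, $\cup$ is multiset union, and $a$ is an atom. *)

theory Defs
  imports "HOL-Library.Multiset"
begin

section \<open>Simple types\<close>

datatype stype = Atom nat | Arrow stype stype (infixr "\<rightarrow>" 200)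

inductive sim :: "stype \<Rightarrow> stype \<Rightarrow> bool" (infix "\<sim>" 50) where
  sim_refl: "\<tau> \<sim> \<tau>"
| sim_sym: "\<tau> \<sim> \<sigma> \<Longrightarrow> \<sigma> \<sim> \<tau>"
| sim_trans: "\<tau> \<sim> \<sigma> \<Longrightarrow> \<sigma> \<sim> \<rho> \<Longrightarrow> \<tau> \<sim> \<rho>"
| sim_arrow: "\<tau> \<sim> \<tau>' \<Longrightarrow> \<sigma> \<sim> \<sigma>' \<Longrightarrow> \<tau> \<rightarrow> \<sigma> \<sim> \<tau>' \<rightarrow> \<sigma>'"
| sim_swap: "\<tau> \<rightarrow> \<sigma> \<rightarrow> \<rho> \<sim> \<sigma> \<rightarrow> \<tau> \<rightarrow> \<rho>"

text \<open>
  A finite multiset of argument types is represented by a list enumerating it; by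
  \<open>arrows_mset_sim\<close> below, the choice of the enumeration is immaterial up to \<open>\<sim>\<close>.
\<close>

primrec arrows :: "stype list \<Rightarrow> stype \<Rightarrow> stype" (infixr "\<rightarrow>*" 200) where
  "[] \<rightarrow>* \<rho> = \<rho>"
| "(\<tau> # \<Sigma>) \<rightarrow>* \<rho> = \<tau> \<rightarrow> (\<Sigma> \<rightarrow>* \<rho>)"

lemma arrows_move_front: "(\<Sigma> @ \<tau> # \<Sigma>') \<rightarrow>* \<rho> \<sim> \<tau> \<rightarrow> ((\<Sigma> @ \<Sigma>') \<rightarrow>* \<rho>)"
proof (induction \<Sigma>)
  case Nil
  show ?case by (simp add: sim_refl)
next
  case (Cons \<sigma> \<Sigma>)
  then have "\<sigma> \<rightarrow> ((\<Sigma> @ \<tau> # \<Sigma>') \<rightarrow>* \<rho>) \<sim> \<sigma> \<rightarrow> \<tau> \<rightarrow> ((\<Sigma> @ \<Sigma>') \<rightarrow>* \<rho>)"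
    by (rule sim_arrow[OF sim_refl])
  then show ?case by (simp, rule sim_trans[OF _ sim_swap])
qed

lemma arrows_mset_sim: "mset \<Sigma> = mset \<Sigma>' \<Longrightarrow> \<Sigma> \<rightarrow>* \<rho> \<sim> \<Sigma>' \<rightarrow>* \<rho>"
proof (induction \<Sigma> arbitrary: \<Sigma>')
  case Nil
  then show ?case by (simp add: sim_refl)
next
  case (Cons \<tau> \<Sigma>)
  then have "\<tau> \<in> set \<Sigma>'" by (metis list.set_intros(1) set_mset_mset)
  then obtain ys zs where eq: "\<Sigma>' = ys @ \<tau> # zs" by (meson split_list)
  with Cons.prems have "mset \<Sigma> = mset (ys @ zs)" by simp
  then have "\<tau> \<rightarrow> (\<Sigma> \<rightarrow>* \<rho>) \<sim> \<tau> \<rightarrow> ((ys @ zs) \<rightarrow>* \<rho>)"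
    by (rule sim_arrow[OF sim_refl Cons.IH])
  then show ?case
    unfolding eq arrows.simps by (rule sim_trans[OF _ sim_sym[OF arrows_move_front]])
qed

section \<open>Simply typed terms in Church style\<close>

text \<open>
  Terms are taken up to \<open>\<alpha>\<close>-conversion, with de Bruijn indices. A type environment is a
  list whose \<open>i\<close>-th entry is the type of the free variable with index \<open>i\<close>.
\<close>

datatype trm = Var nat | App trm trm | Lam stype trm

primrec lift_trm :: "trm \<Rightarrow> nat \<Rightarrow> trm" where
  "lift_trm (Var i) k = (if i < k then Var i else Var (Suc i))"
| "lift_trm (App M N) k = App (lift_trm M k) (lift_trm N k)"
| "lift_trm (Lam \<sigma> M) k = Lam \<sigma> (lift_trm M (Suc k))"

text \<open>
  \<open>subst_trm M N k\<close> replaces index \<open>k\<close> by \<open>N\<close> in \<open>M\<close> and removes it from the environment,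
  so larger indices are decremented.
\<close>

primrec subst_trm :: "trm \<Rightarrow> trm \<Rightarrow> nat \<Rightarrow> trm" where
  "subst_trm (Var i) N k = (if k < i then Var (i - 1) else if i = k then N else Var i)"
| "subst_trm (App M M') N k = App (subst_trm M N k) (subst_trm M' N k)"
| "subst_trm (Lam \<sigma> M) N k = Lam \<sigma> (subst_trm M (lift_trm N 0) (Suc k))"

inductive typing :: "stype list \<Rightarrow> trm \<Rightarrow> stype \<Rightarrow> bool" ("_ \<turnstile> _ \<Colon> _" [50, 50, 50] 50) where
  typing_Var: "i < length E \<Longrightarrow> E \<turnstile> Var i \<Colon> E ! i"
| typing_App: "E \<turnstile> M \<Colon> \<sigma> \<rightarrow> \<tau> \<Longrightarrow> E \<turnstile> N \<Colon> \<sigma> \<Longrightarrow> E \<turnstile> App M N \<Colon> \<tau>"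
| typing_Lam: "\<sigma> # E \<turnstile> M \<Colon> \<tau> \<Longrightarrow> E \<turnstile> Lam \<sigma> M \<Colon> \<sigma> \<rightarrow> \<tau>"

text \<open>
  \<open>\<beta>\<eta>\<close>-equality of typed terms. It is a typed judgement because on ill-typed annotated terms
  \<open>\<beta>\<close> and \<open>\<eta>\<close> together would identify \<open>Lam \<sigma> (Var 0)\<close> with \<open>Lam \<tau> (Var 0)\<close> for all
  \<open>\<sigma>\<close> and \<open>\<tau>\<close>.
\<close>

inductive beta_eta_eq :: "stype list \<Rightarrow> trm \<Rightarrow> trm \<Rightarrow> stype \<Rightarrow> bool"
    ("_ \<turnstile> _ =\<^sub>\<beta>\<^sub>\<eta> _ \<Colon> _" [50, 50, 50, 50] 50) where
  eq_refl: "E \<turnstile> M \<Colon> \<tau> \<Longrightarrow> E \<turnstile> M =\<^sub>\<beta>\<^sub>\<eta> M \<Colon> \<tau>"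
| eq_sym: "E \<turnstile> M =\<^sub>\<beta>\<^sub>\<eta> N \<Colon> \<tau> \<Longrightarrow> E \<turnstile> N =\<^sub>\<beta>\<^sub>\<eta> M \<Colon> \<tau>"
| eq_trans: "E \<turnstile> M =\<^sub>\<beta>\<^sub>\<eta> N \<Colon> \<tau> \<Longrightarrow> E \<turnstile> N =\<^sub>\<beta>\<^sub>\<eta> P \<Colon> \<tau> \<Longrightarrow> E \<turnstile> M =\<^sub>\<beta>\<^sub>\<eta> P \<Colon> \<tau>"
| eq_App: "E \<turnstile> M =\<^sub>\<beta>\<^sub>\<eta> M' \<Colon> \<sigma> \<rightarrow> \<tau> \<Longrightarrow> E \<turnstile> N =\<^sub>\<beta>\<^sub>\<eta> N' \<Colon> \<sigma> \<Longrightarrow> E \<turnstile> App M N =\<^sub>\<beta>\<^sub>\<eta> App M' N' \<Colon> \<tau>"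
| eq_Lam: "\<sigma> # E \<turnstile> M =\<^sub>\<beta>\<^sub>\<eta> M' \<Colon> \<tau> \<Longrightarrow> E \<turnstile> Lam \<sigma> M =\<^sub>\<beta>\<^sub>\<eta> Lam \<sigma> M' \<Colon> \<sigma> \<rightarrow> \<tau>"
| eq_beta: "\<sigma> # E \<turnstile> M \<Colon> \<tau> \<Longrightarrow> E \<turnstile> N \<Colon> \<sigma> \<Longrightarrow> E \<turnstile> App (Lam \<sigma> M) N =\<^sub>\<beta>\<^sub>\<eta> subst_trm M N 0 \<Colon> \<tau>"
| eq_eta: "E \<turnstile> M \<Colon> \<sigma> \<rightarrow> \<tau> \<Longrightarrow> E \<turnstile> Lam \<sigma> (App (lift_trm M 0) (Var 0)) =\<^sub>\<beta>\<^sub>\<eta> M \<Colon> \<sigma> \<rightarrow> \<tau>"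

section \<open>Affine terms and retractions\<close>

primrec occurrences :: "nat \<Rightarrow> trm \<Rightarrow> nat" where
  "occurrences k (Var i) = (if i = k then 1 else 0)"
| "occurrences k (App M N) = occurrences k M + occurrences k N"
| "occurrences k (Lam \<sigma> M) = occurrences (Suc k) M"

primrec bound_at_most_once :: "trm \<Rightarrow> bool" where
  "bound_at_most_once (Var i) \<longleftrightarrow> True"
| "bound_at_most_once (App M N) \<longleftrightarrow> bound_at_most_once M \<and> bound_at_most_once N"
| "bound_at_most_once (Lam \<sigma> M) \<longleftrightarrow> occurrences 0 M \<le> 1 \<and> bound_at_most_once M"

definition affine_trm :: "trm \<Rightarrow> bool" where
  "affine_trm M \<longleftrightarrow> (\<forall>k. occurrences k M \<le> 1) \<and> bound_at_most_once M"

text \<open>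
  The distinguished variable \<open>x : \<rho>\<close> is index \<open>0\<close> of the environment \<open>\<rho> # E\<close>; the decoder
  lives in \<open>E\<close>, so it cannot mention \<open>x\<close>, and is weakened to \<open>\<rho> # E\<close> by lifting.
\<close>

definition coder_decoder :: "stype list \<Rightarrow> trm \<Rightarrow> trm \<Rightarrow> stype \<Rightarrow> stype \<Rightarrow> bool" where
  "coder_decoder E C D \<rho> \<tau> \<longleftrightarrow>
     (\<rho> # E \<turnstile> C \<Colon> \<tau>) \<and> (E \<turnstile> D \<Colon> \<tau> \<rightarrow> \<rho>) \<and>
     (\<rho> # E \<turnstile> App (lift_trm D 0) C =\<^sub>\<beta>\<^sub>\<eta> Var 0 \<Colon> \<rho>)"

definition retract :: "stype \<Rightarrow> stype \<Rightarrow> bool" (infix "\<unlhd>" 50) where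
  "\<rho> \<unlhd> \<tau> \<longleftrightarrow> (\<exists>E C D. coder_decoder E C D \<rho> \<tau>)"

definition affine_retract :: "stype \<Rightarrow> stype \<Rightarrow> bool" (infix "\<unlhd>\<^sup>1" 50) where
  "\<rho> \<unlhd>\<^sup>1 \<tau> \<longleftrightarrow> (\<exists>E C D. coder_decoder E C D \<rho> \<tau> \<and> affine_trm C \<and> affine_trm D)"

section \<open>System CF\<close>

text \<open>
  The rules are stated on representatives; \<open>CF_sim\<close> renders the identification of types
  modulo \<open>\<sim>\<close> at every point of a derivation. The case \<open>n = 0\<close> of \<open>CF_D\<close> is an instance of
  \<open>CF_Axiom\<close>.
\<close>

inductive CF :: "stype \<Rightarrow> stype \<Rightarrow> bool" where
  CF_Axiom: "CF (Atom a) (Atom a)"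
| CF_H: "CF \<sigma> \<sigma>' \<Longrightarrow> CF \<tau> \<tau>' \<Longrightarrow> CF (\<sigma> \<rightarrow> \<tau>) (\<sigma>' \<rightarrow> \<tau>')"
| CF_N: "CF \<rho> \<tau> \<Longrightarrow> CF \<rho> (\<Sigma> \<rightarrow>* \<tau>)"
| CF_D: "(\<And>i. i < n \<Longrightarrow> CF (\<Delta> i \<rightarrow>* Atom a) (\<sigma> i)) \<Longrightarrow>
    CF (concat (map \<Delta> [0..<n]) \<rightarrow>* Atom a)
       (map (\<lambda>i. \<Sigma> i \<rightarrow>* \<sigma> i \<rightarrow> Atom a) [0..<n] \<rightarrow>* Atom a)"
| CF_sim: "CF \<rho> \<tau> \<Longrightarrow> \<rho> \<sim> \<rho>' \<Longrightarrow> \<tau> \<sim> \<tau>' \<Longrightarrow> CF \<rho>' \<tau>'"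

end

theory Submission
  imports Defs "HOL-Library.Nat_Bijection"
begin

text \<open>
  A retraction \<open>x\<^sub>1, \<dots>, x\<^sub>k \<mapsto> D C x\<^sub>1 \<dots> x\<^sub>k = x x\<^sub>1 \<dots> x\<^sub>k\<close> is only ever used through its meaning
  in the full type hierarchy over two-element atoms, which already separates distinct head
  variables and distinct arguments; so neither confluence nor \<open>\<eta>\<close>-long forms are needed.
  Head reduction terminates because it shrinks affine terms.

  The head of the decoder must be the decoded variable, so \<open>D y x\<^sub>1 \<dots> x\<^sub>k\<close> reduces to
  \<open>y D\<^sub>1 \<dots> D\<^sub>m\<close>, and each \<open>x\<^sub>i\<close> lies in exactly one \<open>D\<^sub>j\<close>. Fix \<open>j\<close>, let \<open>z\<close> be fresh, and look
  at the head of \<open>C D\<^sub>1 \<dots> z \<dots> D\<^sub>m\<close> (with \<open>z\<close> in place of \<open>D\<^sub>j\<close>). If it is \<open>z\<close>, so that the term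
  reduces to \<open>z N\<^sub>1 \<dots> N\<^sub>p\<close> with \<open>x\<close> in \<open>N\<^sub>q\<close>, then \<open>N\<^sub>q\<close> and \<open>D\<^sub>j N\<^sub>1 \<dots> v \<dots> N\<^sub>p\<close> form a retraction
  of \<open>\<Delta>\<^sub>j \<rightarrow> a\<close> into the type of \<open>N\<^sub>q\<close>, where \<open>\<Delta>\<^sub>j\<close> are the types of the \<open>x\<^sub>i\<close> in \<open>D\<^sub>j\<close>: this is a
  premise of (D). If it is \<open>x\<close>, then the \<open>i\<close>-th argument of \<open>x\<close> decodes \<open>x\<^sub>i\<close> from \<open>D\<^sub>j\<close> for every
  \<open>x\<^sub>i\<close> in \<open>D\<^sub>j\<close>; as it must contain \<open>z\<close>, there is at most one such \<open>i\<close>, and (H) or (N) applies.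
\<close>

section \<open>The full type hierarchy over two-element atoms\<close>

text \<open>Functions are coded as numbers so that all types share \<open>nat\<close>. The code is
  that of the graph of \<open>f\<close> restricted to \<open>A\<close>, so functions that agree on
  \<open>A\<close> get the same code. Decoding needs \<open>A\<close> finite, whence
  \<open>finite_carrier\<close>.\<close>

definition graph_code :: "nat set \<Rightarrow> (nat \<Rightarrow> nat) \<Rightarrow> nat" where
  "graph_code A f = set_encode ((\<lambda>u. prod_encode (u, f u)) ` A)"

definition app_code :: "nat \<Rightarrow> nat \<Rightarrow> nat" where
  "app_code g u = (THE v. prod_encode (u, v) \<in> set_decode g)"

lemma app_graph_code [simp]:
  assumes "finite A" "u \<in> A"
  shows "app_code (graph_code A f) u = f u"
  using assms by (auto simp: app_code_def graph_code_def)

lemma graph_code_cong: "(\<And>u. u \<in> A \<Longrightarrow> f u = g u) \<Longrightarrow> graph_code A f = graph_code A g"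
  unfolding graph_code_def by (metis (mono_tags, lifting) image_cong)

primrec carrier :: "stype \<Rightarrow> nat set" where
  "carrier (Atom a) = {0, 1}"
| "carrier (\<sigma> \<rightarrow> \<tau>) =
    graph_code (carrier \<sigma>) ` {f. \<forall>u \<in> carrier \<sigma>. f u \<in> carrier \<tau>}"

lemma finite_carrier [simp]: "finite (carrier \<tau>)"
proof (induction \<tau>)
  case (Arrow \<sigma> \<tau>)
  \<comment> \<open>The code ignores values outside \<open>carrier \<sigma>\<close>, so the
    functions that vanish there already give all codes, and there are finitely many of them.\<close>
  let ?X = "{f. \<forall>u. (u \<in> carrier \<sigma> \<longrightarrow> f u \<in> carrier \<tau>) \<and> (u \<notin> carrier \<sigma> \<longrightarrow> f u = (0::nat))}"
  have "carrier (\<sigma> \<rightarrow> \<tau>) \<subseteq> graph_code (carrier \<sigma>) ` ?X"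
  proof
    fix v assume "v \<in> carrier (\<sigma> \<rightarrow> \<tau>)"
    then obtain f where f: "\<forall>u \<in> carrier \<sigma>. f u \<in> carrier \<tau>" and v: "v = graph_code (carrier \<sigma>) f"
      by auto
    have "v = graph_code (carrier \<sigma>) (\<lambda>u. if u \<in> carrier \<sigma> then f u else 0)"
      unfolding v by (rule graph_code_cong) simp
    then show "v \<in> graph_code (carrier \<sigma>) ` ?X"
      using f by auto
  qed
  moreover have "finite ?X"
    using Arrow by (rule finite_set_of_finite_funs)
  ultimately show ?case
    by (meson finite_imageI finite_subset)
qed simp

lemma app_code_carrier [intro]:
  "g \<in> carrier (\<sigma> \<rightarrow> \<tau>) \<Longrightarrow> u \<in> carrier \<sigma> \<Longrightarrow> app_code g u \<in> carrier \<tau>"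
  by auto

text \<open>The element of the hierarchy that represents a predicate on argument tuples. These
  elements are the test values given to \<open>x\<close> and to head variables;
  \<open>of_bool\<close> fits because atoms denote {0, 1}.\<close>

primrec curry_code :: "stype list \<Rightarrow> (nat list \<Rightarrow> bool) \<Rightarrow> nat" where
  "curry_code [] \<phi> = of_bool (\<phi> [])"
| "curry_code (\<sigma> # \<Sigma>) \<phi> = graph_code (carrier \<sigma>) (\<lambda>u. curry_code \<Sigma> (\<lambda>us. \<phi> (u # us)))"

lemma curry_code_carrier [simp]: "curry_code \<Sigma> \<phi> \<in> carrier (\<Sigma> \<rightarrow>* Atom a)"
  by (induction \<Sigma> arbitrary: \<phi>) auto

lemma app_curry_code [simp]:
  "list_all2 (\<lambda>u \<sigma>. u \<in> carrier \<sigma>) us \<Sigma> \<Longrightarrow>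
    foldl app_code (curry_code \<Sigma> \<phi>) us = of_bool (\<phi> us)"
  by (induction us \<Sigma> arbitrary: \<phi> rule: list_all2_induct) auto

lemma stype_arrows_Atom: "\<exists>\<Sigma> a. \<tau> = \<Sigma> \<rightarrow>* Atom a"
proof (induction \<tau>)
  case (Atom a)
  show ?case by (metis arrows.simps(1))
next
  case (Arrow \<sigma> \<tau>)
  then show ?case by (metis arrows.simps(2))
qed

lemma arrows_Atom_inject [simp]:
  "\<Sigma> \<rightarrow>* Atom a = \<Sigma>' \<rightarrow>* Atom b \<longleftrightarrow> \<Sigma> = \<Sigma>' \<and> a = b"
proof (induction \<Sigma> arbitrary: \<Sigma>')
  case Nil
  show ?case by (cases \<Sigma>') auto
next
  case (Cons \<sigma> \<Sigma>)
  then show ?case by (cases \<Sigma>') auto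
qed

lemma carrier_nonempty: "\<exists>u. u \<in> carrier \<tau>"
  using stype_arrows_Atom[of \<tau>] curry_code_carrier by blast

text \<open>The constantly true and the constantly false function differ at any argument tuple, and
  tuples exist. Two distinct values in each type allow the interpretation to notice whether a term
  depends on a variable.\<close>

lemma carrier_nontrivial: "\<exists>u v. u \<in> carrier \<tau> \<and> v \<in> carrier \<tau> \<and> u \<noteq> v"
proof -
  obtain \<Sigma> a where \<tau>: "\<tau> = \<Sigma> \<rightarrow>* Atom a"
    using stype_arrows_Atom by blast
  have "\<exists>us. list_all2 (\<lambda>u \<sigma>. u \<in> carrier \<sigma>) us \<Sigma>"
  proof (induction \<Sigma>)
    case (Cons \<sigma> \<Sigma>)
    then show ?case using carrier_nonempty[of \<sigma>] by (auto simp: list_all2_Cons2)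
  qed simp
  then obtain us where "list_all2 (\<lambda>u \<sigma>. u \<in> carrier \<sigma>) us \<Sigma>" ..
  then have "foldl app_code (curry_code \<Sigma> (\<lambda>_. True)) us \<noteq> foldl app_code (curry_code \<Sigma> (\<lambda>_. False)) us"
    by simp
  then show ?thesis
    unfolding \<tau> by (metis curry_code_carrier)
qed

section \<open>Valuations and the interpretation of terms\<close>

definition valuation :: "stype list \<Rightarrow> (nat \<Rightarrow> nat) \<Rightarrow> bool" where
  "valuation E \<nu> \<longleftrightarrow> (\<forall>i < length E. \<nu> i \<in> carrier (E ! i))"

lemma valuation_Cons: "valuation (\<sigma> # E) (case_nat u \<nu>) \<longleftrightarrow> u \<in> carrier \<sigma> \<and> valuation E \<nu>"
  by (auto simp: valuation_def nth_Cons less_Suc_eq_0_disj split: nat.splits)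

lemma valuation_exists: "\<exists>\<nu>. valuation E \<nu>"
  unfolding valuation_def using carrier_nonempty by meson

lemma valuation_upd: "valuation E \<nu> \<Longrightarrow> (i < length E \<Longrightarrow> u \<in> carrier (E ! i)) \<Longrightarrow> valuation E (\<nu>(i := u))"
  by (auto simp: valuation_def)

lemma valuation_append: "valuation (E @ F) \<nu> \<Longrightarrow> valuation E \<nu>"
  unfolding valuation_def by (metis length_append nth_append trans_less_add1)

lemma valuation_snoc:
  "valuation E \<nu> \<Longrightarrow> u \<in> carrier \<tau> \<Longrightarrow> valuation (E @ [\<tau>]) (\<nu>(length E := u))"
  by (auto simp: valuation_def nth_append less_Suc_eq)

primrec sem :: "trm \<Rightarrow> (nat \<Rightarrow> nat) \<Rightarrow> nat" where
  "sem (Var i) \<nu> = \<nu> i"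
| "sem (App M N) \<nu> = app_code (sem M \<nu>) (sem N \<nu>)"
| "sem (Lam \<sigma> M) \<nu> = graph_code (carrier \<sigma>) (\<lambda>u. sem M (case_nat u \<nu>))"

lemma sem_carrier: "E \<turnstile> M \<Colon> \<tau> \<Longrightarrow> valuation E \<nu> \<Longrightarrow> sem M \<nu> \<in> carrier \<tau>"
proof (induction arbitrary: \<nu> rule: typing.induct)
  case (typing_Var i E)
  then show ?case by (simp add: valuation_def)
next
  case (typing_App E M \<sigma> \<tau> N)
  then show ?case by (metis app_code_carrier sem.simps(2))
next
  case (typing_Lam \<sigma> E M \<tau>)
  then show ?case by (auto simp: valuation_Cons)
qed

lemma sem_cong: "(\<And>i. occurrences i M \<noteq> 0 \<Longrightarrow> \<nu> i = \<mu> i) \<Longrightarrow> sem M \<nu> = sem M \<mu>"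
proof (induction M arbitrary: \<nu> \<mu>)
  case (Lam \<sigma> M)
  have "sem M (case_nat u \<nu>) = sem M (case_nat u \<mu>)" for u
    by (rule Lam.IH) (use Lam.prems in \<open>auto split: nat.splits\<close>)
  then show ?case by simp
next
  case (App M N)
  have "sem M \<nu> = sem M \<mu>" "sem N \<nu> = sem N \<mu>"
    using App.prems by (auto intro!: App.IH)
  then show ?case by simp
qed auto

lemma sem_upd [simp]: "occurrences i M = 0 \<Longrightarrow> sem M (\<nu>(i := u)) = sem M \<nu>"
  by (rule sem_cong) auto

lemma sem_lift: "sem (lift_trm M k) \<nu> = sem M (\<lambda>i. if i < k then \<nu> i else \<nu> (Suc i))"
proof (induction M arbitrary: k \<nu>)
  case (Lam \<sigma> M)
  have "(\<lambda>i. if i < Suc k then case_nat u \<nu> i else case_nat u \<nu> (Suc i)) =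
      case_nat u (\<lambda>i. if i < k then \<nu> i else \<nu> (Suc i))" for u
    by (auto simp: fun_eq_iff split: nat.splits)
  then show ?case by (simp add: Lam)
qed auto

lemma sem_lift_0 [simp]: "sem (lift_trm M 0) (case_nat u \<nu>) = sem M \<nu>"
  by (simp add: sem_lift)

lemma sem_subst:
  "sem (subst_trm M N k) \<nu> =
    sem M (\<lambda>i. if i < k then \<nu> i else if i = k then sem N \<nu> else \<nu> (i - 1))"
proof (induction M arbitrary: k N \<nu>)
  case (Lam \<sigma> M)
  have "(\<lambda>i. if i < Suc k then case_nat u \<nu> i
        else if i = Suc k then sem (lift_trm N 0) (case_nat u \<nu>) else case_nat u \<nu> (i - 1)) =
      case_nat u (\<lambda>i. if i < k then \<nu> i else if i = k then sem N \<nu> else \<nu> (i - 1))" for u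
    by (auto simp: fun_eq_iff split: nat.splits)
  then show ?case by (simp only: subst_trm.simps sem.simps Lam)
qed auto

lemma sem_subst_0: "sem (subst_trm M N 0) \<nu> = sem M (case_nat (sem N \<nu>) \<nu>)"
  unfolding sem_subst by (rule sem_cong) (auto split: nat.splits)

text \<open>Soundness of the interpretation: \<beta> holds because a typed argument denotes an
  element of the carrier, where graphs can be applied, and \<eta> because elements of an arrow
  carrier are determined by their values.\<close>

lemma sem_beta_eta_eq:
  "E \<turnstile> M =\<^sub>\<beta>\<^sub>\<eta> N \<Colon> \<tau> \<Longrightarrow> valuation E \<nu> \<Longrightarrow> sem M \<nu> = sem N \<nu>"
proof (induction arbitrary: \<nu> rule: beta_eta_eq.induct)
  case (eq_Lam \<sigma> E M M' \<tau>)
  then show ?case by (auto simp: valuation_Cons intro!: graph_code_cong)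
next
  case (eq_beta \<sigma> E M \<tau> N)
  then show ?case using sem_carrier by (simp add: sem_subst_0)
next
  case (eq_eta E M \<sigma> \<tau>)
  then have "sem M \<nu> \<in> carrier (\<sigma> \<rightarrow> \<tau>)"
    using sem_carrier by blast
  then show ?case by (auto intro!: graph_code_cong)
qed auto

section \<open>Head reduction of affine terms\<close>

lemma occurrences_lift:
  "occurrences j (lift_trm M k) =
    (if j < k then occurrences j M else if j = k then 0 else occurrences (j - 1) M)"
proof (induction M arbitrary: j k)
  case (Var i)
  then show ?case by auto
next
  case (Lam \<sigma> M)
  then show ?case by (cases j) auto
qed auto

lemma occurrences_subst:
  "occurrences j (subst_trm M N k) =
    (if j < k then occurrences j M else occurrences (Suc j) M) + occurrences k M * occurrences j N"
proof (induction M arbitrary: j k N)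
  case (Var i)
  then show ?case by auto
next
  case (Lam \<sigma> M)
  then show ?case by (simp add: occurrences_lift)
qed (auto simp: algebra_simps)

lemma size_lift [simp]: "size (lift_trm M k) = size M"
  by (induction M arbitrary: k) auto

text \<open>Variables have size 0, so every replaced occurrence adds exactly the size of
  \<open>N\<close>. With at most one occurrence, contracting a redex therefore shrinks the
  term.\<close>

lemma size_subst: "size (subst_trm M N k) = size M + occurrences k M * size N"
  by (induction M arbitrary: k N) (auto simp: algebra_simps)

lemma bound_lift [simp]: "bound_at_most_once (lift_trm M k) = bound_at_most_once M"
  by (induction M arbitrary: k) (auto simp: occurrences_lift)

lemma bound_subst:
  "bound_at_most_once M \<Longrightarrow> bound_at_most_once N \<Longrightarrow> bound_at_most_once (subst_trm M N k)"
  by (induction M arbitrary: k N) (auto simp: occurrences_subst occurrences_lift)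

section \<open>Typing under weakening, lifting and substitution\<close>

inductive_cases typing_VarE: "E \<turnstile> Var i \<Colon> \<tau>"
inductive_cases typing_AppE: "E \<turnstile> App M N \<Colon> \<tau>"
inductive_cases typing_LamE: "E \<turnstile> Lam \<sigma> M \<Colon> \<tau>"

lemma typing_VarI: "i < length E \<Longrightarrow> E ! i = \<tau> \<Longrightarrow> E \<turnstile> Var i \<Colon> \<tau>"
  using typing_Var by blast

lemma typing_append: "E \<turnstile> M \<Colon> \<tau> \<Longrightarrow> E @ F \<turnstile> M \<Colon> \<tau>"
proof (induction rule: typing.induct)
  case (typing_Var i E)
  then show ?case by (auto intro!: typing_VarI simp: nth_append)
qed (auto intro: typing.intros)

lemma occurrences_fresh: "E \<turnstile> M \<Colon> \<tau> \<Longrightarrow> length E \<le> i \<Longrightarrow> occurrences i M = 0"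
  by (induction arbitrary: i rule: typing.induct) auto

lemma typing_lift: "E @ F \<turnstile> M \<Colon> \<tau> \<Longrightarrow> E @ \<sigma> # F \<turnstile> lift_trm M (length E) \<Colon> \<tau>"
proof (induction "E @ F" M \<tau> arbitrary: E rule: typing.induct)
  case (typing_Var i)
  then show ?case by (auto intro!: typing_VarI simp: nth_append nth_Cons Suc_diff_le split: nat.splits)
next
  case (typing_Lam \<sigma>' M \<tau>)
  from typing_Lam(2)[of "\<sigma>' # E"] show ?case by (auto intro: typing.intros)
qed (auto intro: typing.intros)

lemma typing_subst:
  "E @ \<sigma> # F \<turnstile> M \<Colon> \<tau> \<Longrightarrow> E @ F \<turnstile> N \<Colon> \<sigma> \<Longrightarrow> E @ F \<turnstile> subst_trm M N (length E) \<Colon> \<tau>"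
proof (induction "E @ \<sigma> # F" M \<tau> arbitrary: E N rule: typing.induct)
  case (typing_Var i)
  then show ?case
    by (auto intro!: typing_VarI simp: nth_append nth_Cons split: nat.splits)
      (metis Suc_diff_Suc nat.inject)
next
  case (typing_Lam \<sigma>' M \<tau>)
  have "\<sigma>' # E @ F \<turnstile> lift_trm N 0 \<Colon> \<sigma>"
    using typing_lift[of "[]" "E @ F" N \<sigma> \<sigma>'] typing_Lam.prems by simp
  with typing_Lam(2)[of "\<sigma>' # E"] show ?case by (auto intro: typing.intros)
qed (auto intro: typing.intros)

section \<open>Application spines and their head normal forms\<close>

abbreviation Apps :: "trm \<Rightarrow> trm list \<Rightarrow> trm" where
  "Apps \<equiv> foldl App"

lemma typing_App_iff: "E \<turnstile> App M N \<Colon> \<tau> \<longleftrightarrow> (\<exists>\<sigma>. E \<turnstile> M \<Colon> \<sigma> \<rightarrow> \<tau> \<and> E \<turnstile> N \<Colon> \<sigma>)"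
  by (meson typing_App typing_AppE)

lemma typing_Apps:
  "E \<turnstile> Apps M Ns \<Colon> \<tau> \<longleftrightarrow> (\<exists>\<Sigma>. E \<turnstile> M \<Colon> \<Sigma> \<rightarrow>* \<tau> \<and> list_all2 (typing E) Ns \<Sigma>)"
proof (induction Ns arbitrary: M)
  case (Cons N Ns)
  have "E \<turnstile> Apps M (N # Ns) \<Colon> \<tau> \<longleftrightarrow>
      (\<exists>\<Sigma> \<sigma>. E \<turnstile> M \<Colon> (\<sigma> # \<Sigma>) \<rightarrow>* \<tau> \<and> list_all2 (typing E) (N # Ns) (\<sigma> # \<Sigma>))"
    by (auto simp: Cons typing_App_iff)
  also have "\<dots> \<longleftrightarrow> (\<exists>\<Sigma>. E \<turnstile> M \<Colon> \<Sigma> \<rightarrow>* \<tau> \<and> list_all2 (typing E) (N # Ns) \<Sigma>)"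
    by (metis list_all2_Cons1)
  finally show ?case .
qed simp

lemma sem_Apps [simp]: "sem (Apps M Ns) \<nu> = foldl app_code (sem M \<nu>) (map (\<lambda>N. sem N \<nu>) Ns)"
  by (induction Ns arbitrary: M) auto

lemma occurrences_Apps [simp]:
  "occurrences j (Apps M Ns) = occurrences j M + (\<Sum>N\<leftarrow>Ns. occurrences j N)"
  by (induction Ns arbitrary: M) auto

lemma bound_Apps [simp]:
  "bound_at_most_once (Apps M Ns) \<longleftrightarrow> bound_at_most_once M \<and> (\<forall>N \<in> set Ns. bound_at_most_once N)"
  by (induction Ns arbitrary: M) auto

lemma size_Apps: "size (Apps M Ns) = size M + (\<Sum>N\<leftarrow>Ns. Suc (size N))"
  by (induction Ns arbitrary: M) auto

lemma trm_Apps_cases: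
  obtains (Var) i Ns where "M = Apps (Var i) Ns" | (Lam) \<sigma> P Ns where "M = Apps (Lam \<sigma> P) Ns"
proof -
  have "(\<exists>i Ns. M = Apps (Var i) Ns) \<or> (\<exists>\<sigma> P Ns. M = Apps (Lam \<sigma> P) Ns)"
  proof (induction M)
    case (Var i)
    then show ?case by (metis foldl_Nil)
  next
    case (App M N)
    then show ?case by (metis foldl_Cons foldl_Nil foldl_append)
  next
    case (Lam \<sigma> M)
    then show ?case by (metis foldl_Nil)
  qed
  then show ?thesis using that by blast
qed

text \<open>Contract head redexes: each step preserves type and meaning, shrinks the term since the
  argument is copied at most once, and raises no occurrence count. A head abstraction has an
  argument because the whole term has atomic type, so the process stops at a variable applied to all
  the arguments that its type asks for.\<close>

lemma affine_head_normal_form: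
  assumes "E \<turnstile> M \<Colon> Atom a" "bound_at_most_once M"
  obtains h Ns \<Sigma> where "h < length E" "E ! h = \<Sigma> \<rightarrow>* Atom a" "list_all2 (typing E) Ns \<Sigma>"
    "\<And>N. N \<in> set Ns \<Longrightarrow> bound_at_most_once N"
    "\<And>j. (if h = j then 1 else 0) + (\<Sum>N\<leftarrow>Ns. occurrences j N) \<le> occurrences j M"
    "\<And>\<nu>. valuation E \<nu> \<Longrightarrow> sem (Apps (Var h) Ns) \<nu> = sem M \<nu>"
  using assms
proof (induction "size M" arbitrary: M thesis rule: less_induct)
  case less
  show ?case
  proof (cases M rule: trm_Apps_cases)
    case (Var h Ns)
    from less.prems(2) obtain \<Sigma> where "E \<turnstile> Var h \<Colon> \<Sigma> \<rightarrow>* Atom a" "list_all2 (typing E) Ns \<Sigma>"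
      unfolding Var typing_Apps by blast
    moreover from this(1) have "h < length E" "E ! h = \<Sigma> \<rightarrow>* Atom a"
      by (auto elim: typing_VarE)
    ultimately show ?thesis
      using less.prems(3) by (intro less.prems(1)) (auto simp: Var)
  next
    case (Lam \<sigma> P Qs)
    from less.prems(2) obtain \<Sigma> where P: "E \<turnstile> Lam \<sigma> P \<Colon> \<Sigma> \<rightarrow>* Atom a"
      and Qs: "list_all2 (typing E) Qs \<Sigma>"
      unfolding Lam typing_Apps by blast
    from P Qs obtain N Ns \<Sigma>' where eq: "Qs = N # Ns" "\<Sigma> = \<sigma> # \<Sigma>'"
      and P': "\<sigma> # E \<turnstile> P \<Colon> \<Sigma>' \<rightarrow>* Atom a"
      by (cases \<Sigma>) (auto simp: list_all2_Cons2 elim: typing_LamE)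
    have N: "E \<turnstile> N \<Colon> \<sigma>" and Ns: "list_all2 (typing E) Ns \<Sigma>'"
      using Qs unfolding eq by auto
    let ?M = "Apps (subst_trm P N 0) Ns"
    have occ1: "occurrences 0 P \<le> 1" and bound: "bound_at_most_once P" "bound_at_most_once N"
      and boundNs: "\<forall>N \<in> set Ns. bound_at_most_once N"
      using less.prems(3) unfolding Lam eq by auto
    have size: "size ?M < size M"
      using occ1 by (simp add: Lam eq size_Apps size_subst less_Suc_eq_le le_SucI)
    have "E \<turnstile> subst_trm P N 0 \<Colon> \<Sigma>' \<rightarrow>* Atom a"
      using typing_subst[of "[]" \<sigma> E P _ N] P' N by simp
    then have ty: "E \<turnstile> ?M \<Colon> Atom a"
      using Ns typing_Apps by blast
    have bound': "bound_at_most_once ?M"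
      using bound boundNs by (simp add: bound_subst)
    have occ: "occurrences j ?M \<le> occurrences j M" for j
      using occ1 by (simp add: Lam eq occurrences_subst)
    have sem: "sem ?M \<nu> = sem M \<nu>" if "valuation E \<nu>" for \<nu>
      using sem_carrier[OF N that] by (simp add: Lam eq sem_subst_0)
    show ?thesis
    proof (rule less.hyps[OF size _ ty bound'])
      fix h Ns \<Sigma>
      assume *: "h < length E" "E ! h = \<Sigma> \<rightarrow>* Atom a" "list_all2 (typing E) Ns \<Sigma>"
        "\<And>N. N \<in> set Ns \<Longrightarrow> bound_at_most_once N"
        "\<And>j. (if h = j then 1 else 0) + (\<Sum>N\<leftarrow>Ns. occurrences j N) \<le> occurrences j ?M"
        "\<And>\<nu>. valuation E \<nu> \<Longrightarrow> sem (Apps (Var h) Ns) \<nu> = sem ?M \<nu>"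
      show thesis
      proof (rule less.prems(1)[OF *(1-4)])
        show "(if h = j then 1 else 0) + (\<Sum>N\<leftarrow>Ns. occurrences j N) \<le> occurrences j M" for j
          using *(5) occ order_trans by blast
        show "sem (Apps (Var h) Ns) \<nu> = sem M \<nu>" if "valuation E \<nu>" for \<nu>
          by (simp only: *(6) sem that)
      qed
    qed
  qed
qed


section \<open>Splitting a retraction along the arguments of the coded type\<close>

lemma sum_list_map_update:
  "j < length Ns \<Longrightarrow>
    (\<Sum>N\<leftarrow>Ns[j := M]. f N) + f (Ns ! j) = (\<Sum>N\<leftarrow>Ns. f N) + (f M :: nat)"
proof (induction Ns arbitrary: j)
  case (Cons N Ns)
  then show ?case by (cases j) (auto simp: algebra_simps)
qed simp

lemma sum_list_le_1_unique:
  "(\<Sum>N\<leftarrow>Ns. f N) \<le> (1::nat) \<Longrightarrow> i < length Ns \<Longrightarrow> j < length Ns \<Longrightarrow>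
    f (Ns ! i) \<noteq> 0 \<Longrightarrow> f (Ns ! j) \<noteq> 0 \<Longrightarrow> i = j"
proof (induction Ns arbitrary: i j)
  case (Cons N Ns)
  have "f (Ns ! k) = 0" if "f N \<noteq> 0" "k < length Ns" for k
    using that Cons.prems(1) member_le_sum_list[of "f (Ns ! k)" "map f Ns"] by simp
  moreover have "(\<Sum>N\<leftarrow>Ns. f N) \<le> 1"
    using Cons.prems(1) by simp
  ultimately show ?case
    using Cons.IH Cons.prems(2-) by (auto simp: nth_Cons split: nat.splits)
qed simp

lemma sem_list_carrier:
  "list_all2 (typing E) Ns \<Sigma> \<Longrightarrow> valuation E \<nu> \<Longrightarrow>
    list_all2 (\<lambda>u \<sigma>. u \<in> carrier \<sigma>) (map (\<lambda>N. sem N \<nu>) Ns) \<Sigma>"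
  by (auto simp: list_all2_conv_all_nth sem_carrier)

text \<open>The variable \<open>v\<close> gets the meaning of the entry that it replaces, and no
  other entry contains \<open>v\<close>.\<close>

lemma map_sem_update:
  assumes "q < length Ns" "\<And>N. N \<in> set Ns \<Longrightarrow> occurrences v N = 0"
  shows "map (\<lambda>N. sem N (\<nu>(v := sem (Ns ! q) \<nu>))) (Ns[q := Var v]) = map (\<lambda>N. sem N \<nu>) Ns"
  using assms by (auto simp: list_eq_iff_nth_eq nth_list_update)

text \<open>\<open>\<phi>\<close> factors through the coordinates in \<open>ids\<close>: the
  semantic form of deleting the remaining arguments of \<open>x\<close>.\<close>

definition depends_on :: "nat list \<Rightarrow> (nat list \<Rightarrow> bool) \<Rightarrow> bool" where
  "depends_on ids \<phi> \<longleftrightarrow> (\<forall>us vs. (\<forall>i \<in> set ids. us ! i = vs ! i) \<longrightarrow> \<phi> us = \<phi> vs)"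

lemma depends_on_const [simp]: "depends_on ids (\<lambda>_. b)"
  by (simp add: depends_on_def)

lemma depends_on_nth [simp]: "i \<in> set ids \<Longrightarrow> depends_on ids (\<lambda>us. us ! i = u)"
  by (simp add: depends_on_def)

lemma depends_on_mono: "depends_on ids \<phi> \<Longrightarrow> set ids \<subseteq> set ids' \<Longrightarrow> depends_on ids' \<phi>"
  unfolding depends_on_def by blast

text \<open>The data shared by \<open>open_retraction\<close> and \<open>applied_coder\<close>: the
  coded variable \<open>x\<close>, the variables \<open>xs\<close> that stand for its arguments, and
  the positions \<open>ids\<close> to be decoded.\<close>

locale retract_frame =
  fixes E :: "stype list" and \<Delta> :: "stype list" and a :: nat
    and xs :: "nat list" and ids :: "nat list" and x :: nat
  assumes x_less: "x < length E" and x_type: "E ! x = \<Delta> \<rightarrow>* Atom a"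
    and length_xs: "length xs = length \<Delta>"
    and xs_less: "i < length \<Delta> \<Longrightarrow> xs ! i < length E"
    and xs_type: "i < length \<Delta> \<Longrightarrow> E ! (xs ! i) = \<Delta> ! i"
    and ids_less: "i \<in> set ids \<Longrightarrow> i < length \<Delta>"
    and distinct_ids: "distinct ids"
    and x_notin: "x \<notin> set xs"
begin

lemma xs_neq: "i < length \<Delta> \<Longrightarrow> xs ! i \<noteq> x"
  using x_notin length_xs nth_mem by metis

lemma admissible_valuation:
  assumes "valuation E \<nu>"
  shows "valuation E (\<nu>(x := curry_code \<Delta> \<phi>))"
  using assms by (rule valuation_upd) (simp add: x_type)

text \<open>A head other than \<open>x\<close> and \<open>y\<close> may be interpreted as constantly
  false while \<open>x\<close> is constantly true; the term would then denote both 0 and 1. A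
  separate \<open>F\<close> allows \<open>y\<close> to be a variable added to
  \<open>E\<close>.\<close>

lemma head_cases:
  assumes "\<And>\<nu> \<phi>. \<lbrakk>valuation E \<nu>; \<nu> x = curry_code \<Delta> \<phi>; depends_on ids \<phi>\<rbrakk> \<Longrightarrow>
      valuation F (\<nu>(y := sem P \<nu>)) \<and>
      sem (Apps (Var h) Ns) (\<nu>(y := sem P \<nu>)) = of_bool (\<phi> (map \<nu> xs))"
    and "list_all2 (typing F) Ns \<Sigma>" "h < length E" "E ! h = \<Sigma> \<rightarrow>* Atom a"
  shows "h = x \<or> h = y"
proof (rule ccontr)
  assume neq: "\<not> (h = x \<or> h = y)"
  obtain \<nu>\<^sub>0 where "valuation E \<nu>\<^sub>0"
    using valuation_exists by blast
  define \<nu> where "\<nu> = (\<nu>\<^sub>0(x := curry_code \<Delta> (\<lambda>_. True)))(h := curry_code \<Sigma> (\<lambda>_. False))"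
  have "valuation E \<nu>"
    unfolding \<nu>_def using admissible_valuation[OF \<open>valuation E \<nu>\<^sub>0\<close>]
    by (rule valuation_upd) (simp add: assms(4))
  moreover have "\<nu> x = curry_code \<Delta> (\<lambda>_. True)"
    using neq by (simp add: \<nu>_def)
  ultimately have val: "valuation F (\<nu>(y := sem P \<nu>))"
    and eq: "sem (Apps (Var h) Ns) (\<nu>(y := sem P \<nu>)) = 1"
    using assms(1)[of \<nu> "\<lambda>_. True"] by auto
  have "(\<nu>(y := sem P \<nu>)) h = curry_code \<Sigma> (\<lambda>_. False)"
    using neq by (simp add: \<nu>_def)
  then have "sem (Apps (Var h) Ns) (\<nu>(y := sem P \<nu>)) = 0"
    using sem_list_carrier[OF assms(2) val] by simp
  with eq show False by simp
qed

end

text \<open>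
  The decoder is applied to variables \<open>xs\<close>, and only the arguments of \<open>x\<close> at the positions
  \<open>ids\<close> are of interest: the other \<open>xs\<close> are constants, and \<open>x\<close> ranges over those functions that
  ignore them. Thus this is a retraction of \<open>map ((!) \<Delta>) ids \<rightarrow>* Atom a\<close> into \<open>\<tau>\<close>.
\<close>

locale open_retraction = retract_frame +
  fixes y :: nat and C D :: trm and \<tau> :: stype
  assumes y_type: "E ! y = \<tau>"
    and C_type: "E \<turnstile> C \<Colon> \<tau>" and D_type: "E \<turnstile> D \<Colon> Atom a"
    and C_bound: "bound_at_most_once C" and D_bound: "bound_at_most_once D"
    and C_x: "occurrences x C \<le> 1"
    and C_xs: "i \<in> set ids \<Longrightarrow> occurrences (xs ! i) C = 0"
    and D_x: "occurrences x D = 0" and D_y: "occurrences y D \<le> 1"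
    and D_xs: "i \<in> set ids \<Longrightarrow> occurrences (xs ! i) D \<le> 1"
    and decode: "\<lbrakk>valuation E \<nu>; \<nu> x = curry_code \<Delta> \<phi>; depends_on ids \<phi>\<rbrakk> \<Longrightarrow>
      sem D (\<nu>(y := sem C \<nu>)) = of_bool (\<phi> (map \<nu> xs))"

text \<open>The situation after the decoder has been reduced to \<open>y\<close> applied to
  \<open>Ds\<close> and \<open>C\<close> has been put for \<open>y\<close>. The bound on the sums
  says that each variable of interest lies in at most one entry of \<open>Ds\<close>, and at most
  once there.\<close>

locale applied_coder = retract_frame +
  fixes C :: trm and Ts :: "stype list" and Ds :: "trm list"
  assumes C_type: "E \<turnstile> C \<Colon> Ts \<rightarrow>* Atom a" and Ds_type: "list_all2 (typing E) Ds Ts"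
    and C_bound: "bound_at_most_once C"
    and Ds_bound: "D \<in> set Ds \<Longrightarrow> bound_at_most_once D"
    and C_x: "occurrences x C \<le> 1"
    and C_xs: "i \<in> set ids \<Longrightarrow> occurrences (xs ! i) C = 0"
    and Ds_x: "D \<in> set Ds \<Longrightarrow> occurrences x D = 0"
    and Ds_xs: "i \<in> set ids \<Longrightarrow> (\<Sum>D\<leftarrow>Ds. occurrences (xs ! i) D) \<le> 1"
    and decode: "\<lbrakk>valuation E \<nu>; \<nu> x = curry_code \<Delta> \<phi>; depends_on ids \<phi>\<rbrakk> \<Longrightarrow>
      sem (Apps C Ds) \<nu> = of_bool (\<phi> (map \<nu> xs))"

text \<open>The head of the reduced decoder is \<open>x\<close> or \<open>y\<close>, and
  \<open>x\<close> does not occur in the decoder. As \<open>y\<close> occurs at most once, the head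
  is its only occurrence, so putting \<open>C\<close> for \<open>y\<close> leaves \<open>Ds\<close>
  alone.\<close>

lemma (in open_retraction) applied_coder_exists:
  "\<exists>Ts Ds. \<tau> = Ts \<rightarrow>* Atom a \<and> applied_coder E \<Delta> a xs ids x C Ts Ds"
proof -
  obtain h Ds Ts where h: "h < length E" "E ! h = Ts \<rightarrow>* Atom a"
    and Ds: "list_all2 (typing E) Ds Ts" "\<And>D. D \<in> set Ds \<Longrightarrow> bound_at_most_once D"
    and occ: "\<And>j. (if h = j then 1 else 0) + (\<Sum>N\<leftarrow>Ds. occurrences j N) \<le> occurrences j D"
    and sem: "\<And>\<nu>. valuation E \<nu> \<Longrightarrow> sem (Apps (Var h) Ds) \<nu> = sem D \<nu>"
  proof (rule affine_head_normal_form[OF D_type D_bound], goal_cases)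
    case (1 h Ns \<Sigma>)
    show ?case by (rule that; fact 1)
  qed
  have val: "valuation E (\<nu>(y := sem C \<nu>))" if "valuation E \<nu>" for \<nu>
    using that by (rule valuation_upd) (simp add: y_type sem_carrier[OF C_type that])
  have "h = x \<or> h = y"
    by (rule head_cases[where P = C and F = E, OF _ Ds(1) h]) (simp add: val sem decode del: sem_Apps)
  moreover have "h \<noteq> x"
    using occ[of x] D_x by auto
  ultimately have hy: "h = y" by simp
  have "(\<Sum>N\<leftarrow>Ds. occurrences y N) = 0" "(\<Sum>N\<leftarrow>Ds. occurrences x N) = 0"
    using occ[of x] D_x order_trans[OF occ[of y] D_y] hy by simp_all
  then have 0: "occurrences y N = 0" "occurrences x N = 0" if "N \<in> set Ds" for N
    using that by simp_all
  have \<tau>: "\<tau> = Ts \<rightarrow>* Atom a"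
    using h hy y_type by simp
  have "applied_coder E \<Delta> a xs ids x C Ts Ds"
  proof unfold_locales
    fix i assume "i \<in> set ids"
    then have "occurrences (xs ! i) D \<le> 1"
      by (rule D_xs)
    then show "(\<Sum>D\<leftarrow>Ds. occurrences (xs ! i) D) \<le> 1"
      using occ[of "xs ! i"] by linarith
  next
    fix \<nu> \<phi> assume *: "valuation E \<nu>" "\<nu> x = curry_code \<Delta> \<phi>" "depends_on ids \<phi>"
    have "sem (Apps C Ds) \<nu> = sem (Apps (Var h) Ds) (\<nu>(y := sem C \<nu>))"
      using 0 by (simp add: hy cong: map_cong)
    also have "\<dots> = of_bool (\<phi> (map \<nu> xs))"
      using sem[OF val] decode * by simp
    finally show "sem (Apps C Ds) \<nu> = of_bool (\<phi> (map \<nu> xs))" .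
  qed (use C_type \<tau> C_bound C_x C_xs Ds 0 in auto)
  with \<tau> show ?thesis by blast
qed

section \<open>Distributing the decoded positions over the arguments of the coder\<close>

context applied_coder
begin

definition block :: "nat \<Rightarrow> nat list" where
  "block j = filter (\<lambda>i. occurrences (xs ! i) (Ds ! j) \<noteq> 0) ids"

lemma length_Ds: "length Ds = length Ts"
  using Ds_type list_all2_lengthD by blast

text \<open>If no entry contained \<open>xs ! i\<close>, the value of \<open>C\<close> applied to
  \<open>Ds\<close> could not change with that variable. But for the test predicate that compares
  the \<open>i\<close>-th argument with \<open>u\<close>, it must change between two distinct
  elements.\<close>

lemma block_exists:
  assumes i: "i \<in> set ids"
  shows "\<exists>j < length Ts. occurrences (xs ! i) (Ds ! j) \<noteq> 0"
proof (rule ccontr)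
  assume "\<not> ?thesis"
  then have "occurrences (xs ! i) D = 0" if "D \<in> set Ds" for D
    using that by (auto simp: in_set_conv_nth length_Ds)
  then have occ: "occurrences (xs ! i) (Apps C Ds) = 0"
    using C_xs[OF i] by simp
  obtain u v where uv: "u \<in> carrier (\<Delta> ! i)" "v \<in> carrier (\<Delta> ! i)" "u \<noteq> v"
    using carrier_nontrivial by blast
  let ?\<phi> = "\<lambda>us. us ! i = u"
  obtain \<nu>\<^sub>0 where \<nu>\<^sub>0: "valuation E \<nu>\<^sub>0"
    using valuation_exists by blast
  define \<nu> where "\<nu> = \<nu>\<^sub>0(x := curry_code \<Delta> ?\<phi>)"
  have "sem (Apps C Ds) (\<nu>(xs ! i := w)) = of_bool (w = u)" if "w \<in> carrier (\<Delta> ! i)" for w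
  proof -
    have "valuation E \<nu>"
      unfolding \<nu>_def by (rule admissible_valuation[OF \<nu>\<^sub>0])
    then have "valuation E (\<nu>(xs ! i := w))"
      using that by (auto intro: valuation_upd simp: xs_type ids_less[OF i])
    moreover have "(\<nu>(xs ! i := w)) x = curry_code \<Delta> ?\<phi>"
      using xs_neq[OF ids_less[OF i]] by (simp add: \<nu>_def)
    ultimately have "sem (Apps C Ds) (\<nu>(xs ! i := w)) =
        of_bool (?\<phi> (map (\<nu>(xs ! i := w)) xs))"
      by (rule decode[where \<phi> = ?\<phi>]) (simp add: i)
    then show ?thesis
      using ids_less[OF i] length_xs by simp
  qed
  from this[OF uv(1)] this[OF uv(2)] uv(3) occ show False
    by (simp del: sem_Apps)
qed

lemma block_unique:
  "\<lbrakk>i \<in> set ids; j < length Ts; k < length Ts; i \<in> set (block j); i \<in> set (block k)\<rbrakk> \<Longrightarrow> j = k"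
  using sum_list_le_1_unique[OF Ds_xs, of i j k] by (simp add: block_def length_Ds)

text \<open>The alternatives prepare the rules (D), (N) and (H). The first arises when the head,
  after a fresh \<open>z\<close> has been put for \<open>Ds ! j\<close>, is \<open>z\<close>; the
  others when it is \<open>x\<close>. In the last one the roles turn: \<open>Ds ! j\<close> becomes
  the coder of an argument of \<open>x\<close>, which needs a frame of its own.\<close>

lemma block_step:
  assumes j: "j < length Ts"
  shows "(\<exists>\<Sigma> q F y C' D'. Ts ! j = \<Sigma> \<rightarrow>* Atom a \<and> q < length \<Sigma> \<and>
      open_retraction F \<Delta> a xs (block j) x y C' D' (\<Sigma> ! q)) \<or>
    block j = [] \<or>
    (\<exists>i \<Sigma> b F xs' x' y C' D'. block j = [i] \<and> \<Delta> ! i = \<Sigma> \<rightarrow>* Atom b \<and>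
      open_retraction F \<Sigma> b xs' [0..<length \<Sigma>] x' y C' D' (Ts ! j))"
proof -
  \<comment> \<open>The first index outside \<open>E\<close>: adding its type at the end of the
    environment leaves all other indices in place.\<close>
  define z where "z = length E"
  define T where "T = Ts ! j"
  define F where "F = E @ [T]"
  define M where "M = Apps C (Ds[j := Var z])"
  have jD: "j < length Ds"
    using j length_Ds by simp
  have Dj: "E \<turnstile> Ds ! j \<Colon> T"
    using Ds_type j unfolding T_def by (simp add: list_all2_conv_all_nth)
  have Dj_in: "Ds ! j \<in> set Ds"
    using jD by simp
  have fresh: "occurrences z N = 0" if "E \<turnstile> N \<Colon> \<sigma>" for N \<sigma>
    using that by (simp add: z_def occurrences_fresh)
  have fresh_Ds: "occurrences z D = 0" if "D \<in> set Ds" for D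
    using that Ds_type fresh by (metis in_set_conv_nth list_all2_conv_all_nth)
  have F_z: "z < length F" "F ! z = T" and F_E: "\<And>i. i < length E \<Longrightarrow> F ! i = E ! i"
    by (auto simp: F_def z_def nth_append)
  have "list_all2 (typing F) Ds Ts"
    using Ds_type by (auto simp: F_def typing_append list_all2_conv_all_nth)
  then have "list_all2 (typing F) (Ds[j := Var z]) (Ts[j := T])"
    using F_z by (intro list_all2_update_cong) (auto intro: typing_VarI)
  then have M_type: "F \<turnstile> M \<Colon> Atom a"
    unfolding M_def typing_Apps T_def using C_type by (auto simp: F_def intro: typing_append)
  have M_bound: "bound_at_most_once M"
    using C_bound Ds_bound by (auto simp: M_def dest!: set_update_subset_insert[THEN subsetD])
  obtain h Ns \<Sigma> where h: "h < length F" "F ! h = \<Sigma> \<rightarrow>* Atom a"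
    and Ns: "list_all2 (typing F) Ns \<Sigma>" "\<And>N. N \<in> set Ns \<Longrightarrow> bound_at_most_once N"
    and occ: "\<And>k. (if h = k then 1 else 0) + (\<Sum>N\<leftarrow>Ns. occurrences k N) \<le> occurrences k M"
    and sem: "\<And>\<nu>. valuation F \<nu> \<Longrightarrow> sem (Apps (Var h) Ns) \<nu> = sem M \<nu>"
  proof (rule affine_head_normal_form[OF M_type M_bound], goal_cases)
    case (1 h Ns \<Sigma>)
    show ?case by (rule that; fact 1)
  qed
  have occ_M: "occurrences k M + occurrences k (Ds ! j) =
      occurrences k C + (\<Sum>D\<leftarrow>Ds. occurrences k D) + occurrences k (Var z)" for k
    using sum_list_map_update[OF jD, of "occurrences k" "Var z"] by (simp add: M_def)
  have "(\<Sum>D\<leftarrow>Ds. occurrences z D) = 0"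
    using fresh_Ds by simp
  then have occ_z: "occurrences z M \<le> 1"
    using occ_M[of z] fresh[OF C_type] by (simp del: sum_list_eq_0_iff)
  have sum_x: "(\<Sum>D\<leftarrow>Ds. occurrences x D) = 0"
    using Ds_x by simp
  have x_neq_z: "x \<noteq> z"
    using x_less by (simp add: z_def)
  have occ_x: "occurrences x M \<le> 1"
    using occ_M[of x] sum_x C_x x_neq_z by (simp del: sum_list_eq_0_iff)
  \<comment> \<open>The only occurrence of this variable in \<open>C\<close> and \<open>Ds\<close>
    is the one in \<open>Ds ! j\<close>, which \<open>z\<close> has replaced.\<close>
  have occ_block: "occurrences (xs ! i) M = 0" if "i \<in> set (block j)" for i
  proof -
    have i: "i \<in> set ids" "occurrences (xs ! i) (Ds ! j) \<noteq> 0"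
      using that by (auto simp: block_def)
    then have "xs ! i \<noteq> z"
      using xs_less ids_less z_def by fastforce
    then show ?thesis
      using occ_M[of "xs ! i"] C_xs[OF i(1)] Ds_xs[OF i(1)] i(2) by simp
  qed
  have Ns_block: "occurrences (xs ! i) N = 0" if "i \<in> set (block j)" "N \<in> set Ns" for i N
    using occ[of "xs ! i"] occ_block that by auto
  have val: "valuation F (\<nu>(z := sem (Ds ! j) \<nu>))" if "valuation E \<nu>" for \<nu>
    unfolding F_def z_def using that sem_carrier[OF Dj that] by (rule valuation_snoc)
  have decode_M: "sem (Apps (Var h) Ns) (\<nu>(z := sem (Ds ! j) \<nu>)) = of_bool (\<phi> (map \<nu> xs))"
    if "valuation E \<nu>" "\<nu> x = curry_code \<Delta> \<phi>" "depends_on ids \<phi>" for \<nu> \<phi>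
  proof -
    have "sem M (\<nu>(z := sem (Ds ! j) \<nu>)) = sem (Apps C Ds) \<nu>"
      using map_sem_update[OF jD fresh_Ds] fresh[OF C_type] by (simp add: M_def)
    then show ?thesis
      using sem[OF val[OF that(1)]] decode[OF that] by simp
  qed
  have "h = x \<or> h = z"
  proof (rule ccontr)
    assume neq: "\<not> (h = x \<or> h = z)"
    then have "h < length E"
      using h(1) by (auto simp: F_def z_def)
    with h(2) have "E ! h = \<Sigma> \<rightarrow>* Atom a"
      by (simp add: F_E)
    from head_cases[where P = "Ds ! j" and F = F and y = z, OF _ Ns(1) \<open>h < length E\<close> this]
    show False
      using neq val decode_M by blast
  qed
  then consider "h = z" | "h = x" by blast
  then show ?thesis
  proof cases
    case 1
    have T: "T = \<Sigma> \<rightarrow>* Atom a"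
      using h(2) F_z 1 by simp
    have Ns_z: "occurrences z N = 0" if "N \<in> set Ns" for N
      using that order_trans[OF occ[of z] occ_z] 1 by simp
    have decode_Ns: "foldl app_code (sem (Ds ! j) \<nu>) (map (\<lambda>N. sem N \<nu>) Ns) = of_bool (\<phi> (map \<nu> xs))"
      if "valuation E \<nu>" "\<nu> x = curry_code \<Delta> \<phi>" "depends_on ids \<phi>" for \<nu> \<phi>
      using decode_M[OF that] 1 Ns_z by (simp cong: map_cong)
    \<comment> \<open>Otherwise neither \<open>Ds ! j\<close> nor the arguments \<open>Ns\<close>
      would see \<open>x\<close>, and one value would have to be the result for both constant
      predicates.\<close>
    have "\<exists>N \<in> set Ns. occurrences x N \<noteq> 0"
    proof (rule ccontr)
      assume "\<not> ?thesis"
      then have Ns_x: "occurrences x N = 0" if "N \<in> set Ns" for N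
        using that by blast
      obtain \<nu> where \<nu>: "valuation E \<nu>"
        using valuation_exists by blast
      have "foldl app_code (sem (Ds ! j) \<nu>) (map (\<lambda>N. sem N \<nu>) Ns) = of_bool b" for b
        using decode_Ns[OF admissible_valuation[OF \<nu>, of "\<lambda>_. b"], of "\<lambda>_. b"]
          Ds_x[OF Dj_in] Ns_x by (simp cong: map_cong)
      from this[of True] this[of False] show False by simp
    qed
    then obtain q where q: "q < length Ns" "occurrences x (Ns ! q) \<noteq> 0"
      by (metis in_set_conv_nth)
    have q': "q < length \<Sigma>"
      using q(1) Ns(1) by (simp add: list_all2_lengthD)
    have Nq: "F \<turnstile> Ns ! q \<Colon> \<Sigma> ! q"
      using Ns(1) q(1) by (simp add: list_all2_conv_all_nth)
    have Ns_sum_x: "(\<Sum>N\<leftarrow>Ns. occurrences x N) \<le> 1"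
      using occ[of x] occ_x by simp
    \<comment> \<open>A fresh variable for the entry that carries \<open>x\<close>: it stands for
      the code in the new retraction, whose coder is \<open>Ns ! q\<close>.\<close>
    define v where "v = length F"
    define G where "G = F @ [\<Sigma> ! q]"
    have G_v: "v < length G" "G ! v = \<Sigma> ! q" and G_E: "\<And>i. i < length E \<Longrightarrow> G ! i = E ! i"
      and lG: "length E < length G"
      by (auto simp: G_def F_def v_def nth_append)
    have v_fresh: "occurrences v N = 0" if "N \<in> set Ns" for N
      using that Ns(1) occurrences_fresh v_def by (metis in_set_conv_nth list_all2_conv_all_nth order_refl)
    have v_Dj: "occurrences v (Ds ! j) = 0"
      using occurrences_fresh[OF Dj] by (simp add: v_def F_def)
    have "xs ! i \<noteq> v" if "i < length \<Delta>" for i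
      using xs_less[OF that] by (simp add: v_def F_def)
    then have v_neq: "v \<noteq> x" "v \<notin> set xs"
      using x_less by (auto simp: v_def F_def in_set_conv_nth length_xs)
    define D' where "D' = Apps (Ds ! j) (Ns[q := Var v])"
    have occ_D': "occurrences k D' + occurrences k (Ns ! q) =
        occurrences k (Ds ! j) + (\<Sum>N\<leftarrow>Ns. occurrences k N) + occurrences k (Var v)" for k
      using sum_list_map_update[OF q(1), of "occurrences k" "Var v"] by (simp add: D'_def)
    have "open_retraction G \<Delta> a xs (block j) x v (Ns ! q) D' (\<Sigma> ! q)"
    proof unfold_locales
      show "x < length G" "G ! x = \<Delta> \<rightarrow>* Atom a"
        using x_less x_type lG G_E by auto
      show "length xs = length \<Delta>" "x \<notin> set xs" "distinct (block j)"
        using length_xs x_notin distinct_ids by (auto simp: block_def)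
      show "xs ! i < length G" "G ! (xs ! i) = \<Delta> ! i" if "i < length \<Delta>" for i
        using xs_less[OF that] xs_type[OF that] lG G_E by auto
      show "i < length \<Delta>" if "i \<in> set (block j)" for i
        using that ids_less by (auto simp: block_def)
      show "G ! v = \<Sigma> ! q"
        by (fact G_v)
      show "G \<turnstile> Ns ! q \<Colon> \<Sigma> ! q"
        unfolding G_def by (rule typing_append[OF Nq])
      have "list_all2 (typing G) Ns \<Sigma>"
        using Ns(1) by (auto simp: G_def typing_append list_all2_conv_all_nth)
      then have "list_all2 (typing G) (Ns[q := Var v]) (\<Sigma>[q := \<Sigma> ! q])"
        using G_v by (intro list_all2_update_cong) (auto intro: typing_VarI)
      moreover have "G \<turnstile> Ds ! j \<Colon> \<Sigma> \<rightarrow>* Atom a"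
        using Dj unfolding G_def F_def T by (simp add: typing_append)
      ultimately show "G \<turnstile> D' \<Colon> Atom a"
        unfolding D'_def typing_Apps by auto
      show "bound_at_most_once (Ns ! q)"
        using Ns(2) q(1) by simp
      show "bound_at_most_once D'"
        using Ns(2) Ds_bound[OF Dj_in] by (auto simp: D'_def dest!: set_update_subset_insert[THEN subsetD])
      show "occurrences x (Ns ! q) \<le> 1"
        using member_le_sum_list[of "occurrences x (Ns ! q)" "map (occurrences x) Ns"] Ns_sum_x q(1)
        by simp
      show "occurrences (xs ! i) (Ns ! q) = 0" if "i \<in> set (block j)" for i
        using Ns_block that q(1) by simp
      \<comment> \<open>The one occurrence of \<open>x\<close> sits in \<open>Ns ! q\<close>, which
        \<open>v\<close> has replaced.\<close>
      show "occurrences x D' = 0"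
        using occ_D'[of x] Ns_sum_x q(2) Ds_x[OF Dj_in] v_neq by simp
      have "(\<Sum>N\<leftarrow>Ns. occurrences v N) = 0"
        using v_fresh by simp
      then show "occurrences v D' \<le> 1"
        using occ_D'[of v] v_Dj by (simp del: sum_list_eq_0_iff)
      show "occurrences (xs ! i) D' \<le> 1" if "i \<in> set (block j)" for i
      proof -
        have i: "i \<in> set ids"
          using that by (simp add: block_def)
        have "xs ! i \<noteq> v"
          using v_neq ids_less[OF i] length_xs by (metis nth_mem)
        moreover have "occurrences (xs ! i) (Ds ! j) \<le> 1"
          using Ds_xs[OF i] jD member_le_sum_list[of "occurrences (xs ! i) (Ds ! j)" "map (occurrences (xs ! i)) Ds"]
          by simp
        moreover have "(\<Sum>N\<leftarrow>Ns. occurrences (xs ! i) N) = 0"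
          using Ns_block[OF that] by simp
        ultimately show ?thesis
          using occ_D'[of "xs ! i"] by (simp del: sum_list_eq_0_iff)
      qed
      show "sem D' (\<nu>(v := sem (Ns ! q) \<nu>)) = of_bool (\<phi> (map \<nu> xs))"
        if "valuation G \<nu>" "\<nu> x = curry_code \<Delta> \<phi>" "depends_on (block j) \<phi>" for \<nu> \<phi>
      proof -
        have "valuation E \<nu>"
          using that(1) unfolding G_def F_def by (metis valuation_append)
        moreover have "depends_on ids \<phi>"
          using that(3) by (rule depends_on_mono) (auto simp: block_def)
        ultimately show ?thesis
          using decode_Ns that(2) map_sem_update[OF q(1) v_fresh] v_Dj by (simp add: D'_def)
      qed
    qed
    then show ?thesis
      using T q' unfolding T_def by blast
  next
    case 2
    have \<Sigma>: "\<Sigma> = \<Delta>"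
      using h(2) 2 x_type F_E[OF x_less] by simp
    have lNs: "length Ns = length \<Delta>"
      using Ns(1) \<Sigma> list_all2_lengthD by blast
    have Ns_x: "occurrences x N = 0" if "N \<in> set Ns" for N
      using that order_trans[OF occ[of x] occ_x] 2 by simp
    have Ns_sum_z: "(\<Sum>N\<leftarrow>Ns. occurrences z N) \<le> 1"
      using occ[of z] occ_z by simp
    \<comment> \<open>The value of \<open>x\<close> can be chosen freely, since neither
      \<open>Ds ! j\<close> nor \<open>Ns\<close> contains \<open>x\<close>. Choosing the test
      whether the \<open>i\<close>-th argument equals \<open>\<nu> (xs ! i)\<close> turns the
      decoding equation into the claim that \<open>Ns ! i\<close> denotes that value.\<close>
    have decode_N: "sem (Ns ! i) (\<nu>(z := sem (Ds ! j) \<nu>)) = \<nu> (xs ! i)"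
      if \<nu>: "valuation E \<nu>" and i: "i \<in> set ids" for \<nu> i
    proof -
      have i': "i < length \<Delta>"
        using ids_less[OF i] .
      define \<phi> where "\<phi> = (\<lambda>us. us ! i = \<nu> (xs ! i))"
      define \<mu> where "\<mu> = \<nu>(x := curry_code \<Delta> \<phi>)"
      define \<mu>' where "\<mu>' = \<mu>(z := sem (Ds ! j) \<mu>)"
      have \<mu>: "valuation E \<mu>"
        unfolding \<mu>_def by (rule admissible_valuation[OF \<nu>])
      have x\<mu>: "\<mu> x = curry_code \<Delta> \<phi>" "\<mu>' x = curry_code \<Delta> \<phi>"
        using x_neq_z by (auto simp: \<mu>_def \<mu>'_def)
      have "of_bool (\<phi> (map \<mu> xs)) = sem (Apps (Var h) Ns) \<mu>'"
        unfolding \<mu>'_def by (rule decode_M[OF \<mu> x\<mu>(1), symmetric]) (simp add: \<phi>_def i)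
      also have "\<dots> = of_bool (\<phi> (map (\<lambda>N. sem N \<mu>') Ns))"
        using sem_list_carrier[OF Ns(1) val[OF \<mu>]] by (simp add: 2 x\<mu> \<Sigma> \<mu>'_def[symmetric])
      finally have "(\<mu> (xs ! i) = \<nu> (xs ! i)) = (sem (Ns ! i) \<mu>' = \<nu> (xs ! i))"
        using i' length_xs lNs by (simp add: \<phi>_def of_bool_eq_iff)
      moreover have "\<mu> (xs ! i) = \<nu> (xs ! i)"
        using xs_neq[OF i'] by (simp add: \<mu>_def)
      moreover have "\<mu>' = (\<nu>(z := sem (Ds ! j) \<nu>))(x := curry_code \<Delta> \<phi>)"
        using Ds_x[OF Dj_in] x_neq_z by (simp add: \<mu>'_def \<mu>_def fun_upd_twist)
      ultimately show ?thesis
        using Ns_x i' lNs by simp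
    qed
    \<comment> \<open>The block variable \<open>xs ! i\<close> does not occur in
      \<open>Ns ! i\<close>. Without \<open>z\<close> the value of \<open>Ns ! i\<close> would be
      independent of \<open>xs ! i\<close>, yet by \<open>decode_N\<close> it has to follow it
      through two distinct values.\<close>
    have Ns_z: "occurrences z (Ns ! i) \<noteq> 0" if "i \<in> set (block j)" for i
    proof
      assume z0: "occurrences z (Ns ! i) = 0"
      have i: "i \<in> set ids" and i': "i < length \<Delta>"
        using that ids_less by (auto simp: block_def)
      obtain u v where uv: "u \<in> carrier (\<Delta> ! i)" "v \<in> carrier (\<Delta> ! i)" "u \<noteq> v"
        using carrier_nontrivial by blast
      obtain \<nu> where \<nu>: "valuation E \<nu>"
        using valuation_exists by blast
      have "sem (Ns ! i) \<nu> = w" if "w \<in> carrier (\<Delta> ! i)" for w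
      proof -
        have "valuation E (\<nu>(xs ! i := w))"
          using \<nu> by (rule valuation_upd) (simp add: xs_type[OF i'] that)
        from decode_N[OF this i] show ?thesis
          using z0 Ns_block[OF \<open>i \<in> set (block j)\<close>] i' lNs by simp
      qed
      from this[OF uv(1)] this[OF uv(2)] uv(3) show False by simp
    qed
    show ?thesis
    proof (cases "block j")
      case Nil
      then show ?thesis by simp
    next
      case (Cons i is')
      have block_less: "k < length Ns" if "k \<in> set (block j)" for k
        using that lNs ids_less by (simp add: block_def)
      have iblk: "i \<in> set (block j)"
        using Cons by simp
      \<comment> \<open>The entries of \<open>Ns\<close> share at most one occurrence of
        \<open>z\<close>, so only one of them can serve a position of the block.\<close>
      have "k = i" if "k \<in> set (block j)" for k
        using sum_list_le_1_unique[OF Ns_sum_z] block_less Ns_z iblk that by blast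
      moreover have "distinct (block j)"
        using distinct_ids by (simp add: block_def)
      ultimately have blk: "block j = [i]"
        using Cons by (cases is') auto
      have i: "i \<in> set ids" and i': "i < length \<Delta>"
        using iblk ids_less by (auto simp: block_def)
      obtain V b where V: "\<Delta> ! i = V \<rightarrow>* Atom b"
        using stype_arrows_Atom by blast
      \<comment> \<open>Fresh variables for the arguments of \<open>\<Delta> ! i\<close> bring the
        decoder \<open>Ns ! i\<close> to atomic type.\<close>
      define G where "G = F @ V"
      define vs where "vs = [length F..<length F + length V]"
      define D' where "D' = Apps (Ns ! i) (map Var vs)"
      have Ni: "F \<turnstile> Ns ! i \<Colon> V \<rightarrow>* Atom b"
        using Ns(1) i' lNs V \<Sigma> by (metis list_all2_conv_all_nth)
      have Ni_in: "Ns ! i \<in> set Ns"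
        using i' lNs by simp
      have lF: "length F = Suc z" "length G = Suc (z + length V)"
        by (auto simp: F_def G_def z_def)
      have G_E: "\<And>k. k < length E \<Longrightarrow> G ! k = E ! k" and G_z: "G ! z = T"
        by (auto simp: G_def F_def z_def nth_append)
      have xi: "xs ! i < z"
        using xs_less[OF i'] by (simp add: z_def)
      have occ_vs: "occurrences k D' = occurrences k (Ns ! i) + (if k \<in> set vs then 1 else 0)" for k
      proof -
        have "distinct vs \<Longrightarrow> (\<Sum>N\<leftarrow>map Var vs. occurrences k N) = (if k \<in> set vs then 1 else 0)"
          by (induction vs) auto
        then show ?thesis by (simp add: D'_def vs_def)
      qed
      have vs_nth: "vs ! k = Suc z + k" if "k < length V" for k
        using that lF unfolding vs_def by (subst nth_upt) auto
      have occ_Dj: "occurrences k (Ds ! j) = 0" if "z \<le> k" for k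
        using occurrences_fresh[OF Dj] that by (simp add: z_def)
      have occ_Ni: "occurrences k (Ns ! i) = 0" if "z < k" for k
        using occurrences_fresh[OF Ni] that lF by simp
      \<comment> \<open>Now \<open>xs ! i\<close> is the coded variable, \<open>z\<close> stands for
        its code, and all the arguments \<open>vs\<close> are to be decoded.\<close>
      have "open_retraction G V b vs [0..<length V] (xs ! i) z (Ds ! j) D' (Ts ! j)"
      proof unfold_locales
        show "xs ! i < length G" "G ! (xs ! i) = V \<rightarrow>* Atom b"
          using xi lF xs_less[OF i'] xs_type[OF i'] G_E V by auto
        show "length vs = length V" "distinct [0..<length V]"
          by (auto simp: vs_def)
        show "vs ! k < length G" "G ! (vs ! k) = V ! k" if "k < length V" for k
          using that by (auto simp: vs_def G_def)
        show "k < length V" if "k \<in> set [0..<length V]" for k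
          using that by simp
        show "xs ! i \<notin> set vs"
          using xi lF by (auto simp: vs_def)
        show "G ! z = Ts ! j"
          using G_z by (simp add: T_def)
        show "G \<turnstile> Ds ! j \<Colon> Ts ! j"
          using Dj unfolding T_def G_def F_def by (simp add: typing_append)
        have "list_all2 (typing G) (map Var vs) V"
          by (auto simp: list_all2_conv_all_nth vs_def G_def intro!: typing_VarI)
        then show "G \<turnstile> D' \<Colon> Atom b"
          unfolding D'_def typing_Apps using Ni by (auto simp: G_def intro: typing_append)
        show "bound_at_most_once (Ds ! j)" "bound_at_most_once D'"
          using Ds_bound[OF Dj_in] Ns(2)[OF Ni_in] by (auto simp: D'_def)
        show "occurrences (xs ! i) (Ds ! j) \<le> 1"
          using Ds_xs[OF i] jD
            member_le_sum_list[of "occurrences (xs ! i) (Ds ! j)" "map (occurrences (xs ! i)) Ds"]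
          by simp
        show "occurrences (vs ! k) (Ds ! j) = 0" if "k \<in> set [0..<length V]" for k
          using that by (simp add: occ_Dj vs_nth)
        show "occurrences (xs ! i) D' = 0"
          using Ns_block[OF iblk Ni_in] xi lF by (auto simp: occ_vs vs_def)
        show "occurrences z D' \<le> 1"
          using Ns_sum_z i' lNs lF member_le_sum_list[of "occurrences z (Ns ! i)" "map (occurrences z) Ns"]
          by (auto simp: occ_vs vs_def)
        show "occurrences (vs ! k) D' \<le> 1" if "k \<in> set [0..<length V]" for k
          using that by (simp add: occ_vs vs_nth occ_Ni)
        show "sem D' (\<nu>(z := sem (Ds ! j) \<nu>)) = of_bool (\<phi> (map \<nu> vs))"
          if "valuation G \<nu>" "\<nu> (xs ! i) = curry_code V \<phi>" for \<nu> \<phi>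
        proof -
          have "valuation E \<nu>"
            using that(1) unfolding G_def F_def by (metis valuation_append)
          from decode_N[OF this i] have "sem (Ns ! i) (\<nu>(z := sem (Ds ! j) \<nu>)) = curry_code V \<phi>"
            using that(2) by simp
          moreover have "map (\<lambda>N. sem N (\<nu>(z := sem (Ds ! j) \<nu>))) (map Var vs) = map \<nu> vs"
            using lF by (auto simp: vs_def)
          moreover have "list_all2 (\<lambda>u \<sigma>. u \<in> carrier \<sigma>) (map \<nu> vs) V"
            using that(1) by (auto simp: list_all2_conv_all_nth vs_def valuation_def G_def)
              (metis add_less_cancel_left nth_append_length_plus)
          ultimately show ?thesis
            by (simp only: D'_def sem_Apps app_curry_code)
        qed
      qed
      then show ?thesis
        using blk V by blast
    qed
  qed
qed

end

section \<open>Assembling the derivation in CF\<close>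

lemma arrows_append [simp]: "(\<Sigma> @ \<Sigma>') \<rightarrow>* \<rho> = \<Sigma> \<rightarrow>* \<Sigma>' \<rightarrow>* \<rho>"
  by (induction \<Sigma>) auto

lemma sim_arrows: "list_all2 sim \<Sigma> \<Sigma>' \<Longrightarrow> \<Sigma> \<rightarrow>* \<rho> \<sim> \<Sigma>' \<rightarrow>* \<rho>"
  by (induction rule: list_all2_induct) (auto intro: sim_refl sim_arrow)

text \<open>Rule (D) wants the argument that carries the retraction in last position.\<close>

lemma arrows_move_last:
  assumes "q < length \<Sigma>"
  shows "(take q \<Sigma> @ drop (Suc q) \<Sigma>) \<rightarrow>* (\<Sigma> ! q) \<rightarrow> \<rho> \<sim> \<Sigma> \<rightarrow>* \<rho>"
proof -
  have "mset ((take q \<Sigma> @ drop (Suc q) \<Sigma>) @ [\<Sigma> ! q]) = mset (take q \<Sigma> @ \<Sigma> ! q # drop (Suc q) \<Sigma>)"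
    by simp
  also have "\<dots> = mset \<Sigma>"
    using id_take_nth_drop[OF assms] by simp
  finally have "((take q \<Sigma> @ drop (Suc q) \<Sigma>) @ [\<Sigma> ! q]) \<rightarrow>* \<rho> \<sim> \<Sigma> \<rightarrow>* \<rho>"
    by (rule arrows_mset_sim)
  then show ?thesis by simp
qed

lemma mset_concat_filter:
  "mset (concat (map f (filter (\<lambda>j. \<not> P j) js) @ map f (filter P js))) = mset (concat (map f js))"
  by (induction js) auto

text \<open>Every element lies in exactly one block, so concatenating the blocks permutes
  \<open>ids\<close>. The induction removes the block of the first index; this does not affect the
  other filters, since their elements lie in no second block.\<close>

lemma mset_concat_blocks:
  assumes "distinct js" "\<And>i. i \<in> set ids \<Longrightarrow> \<exists>!j. j \<in> set js \<and> P j i"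
  shows "mset (concat (map (\<lambda>j. filter (P j) ids) js)) = mset ids"
  using assms
proof (induction js arbitrary: ids)
  case Nil
  then show ?case by (cases ids) auto
next
  case (Cons j js)
  let ?ids = "filter (\<lambda>i. \<not> P j i) ids"
  have "\<exists>!k. k \<in> set js \<and> P k i" if "i \<in> set ?ids" for i
    using Cons.prems(2)[of i] that by (auto simp: Ex1_def)
  then have "mset (concat (map (\<lambda>j. filter (P j) ?ids) js)) = mset ?ids"
    using Cons.prems(1) by (intro Cons.IH) simp_all
  moreover have "\<not> P j i" if "j' \<in> set js" "i \<in> set ids" "P j' i" for i j'
    using Cons.prems(1) Cons.prems(2)[of i] that by auto
  then have "filter (P j') ?ids = filter (P j') ids" if "j' \<in> set js" for j'
    using that by (auto intro!: filter_cong)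
  ultimately show ?case
    by (simp cong: map_cong)
qed

text \<open>One target type is added at a time: by (H) when its block is a single source type, by
  (N) when the block is empty.\<close>

lemma CF_combine_nonhead:
  assumes "\<And>j. j \<in> set js \<Longrightarrow> \<Delta> j = [] \<or> (\<exists>\<rho>. \<Delta> j = [\<rho>] \<and> CF \<rho> (T j))" "CF \<rho> \<tau>"
  shows "CF (concat (map \<Delta> js) \<rightarrow>* \<rho>) (map T js \<rightarrow>* \<tau>)"
  using assms(1)
proof (induction js)
  case (Cons j js)
  then have IH: "CF (concat (map \<Delta> js) \<rightarrow>* \<rho>) (map T js \<rightarrow>* \<tau>)"
    by simp
  show ?case
    using Cons.prems[of j] CF_H[OF _ IH] CF_N[OF IH, of "[T j]"] by auto
qed (simp add: assms(2))

lemma map_comp_nth: "map (\<lambda>i. f (xs ! i)) [0..<length xs] = map f xs"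
  by (rule nth_equalityI) simp_all

text \<open>One use of (D) treats all targets of the \<open>spine\<close> kind together, including
  the case that there are none. The others are then put in front by
  \<open>CF_combine_nonhead\<close>, and \<open>\<sim>\<close> restores the original order.\<close>

lemma CF_combine:
  fixes a :: nat and js :: "'a list"
  defines "spine \<equiv> \<lambda>\<Delta> T. \<exists>\<Sigma> q. T = \<Sigma> \<rightarrow>* Atom a \<and> q < length \<Sigma> \<and> CF (\<Delta> \<rightarrow>* Atom a) (\<Sigma> ! q)"
  assumes "\<And>j. j \<in> set js \<Longrightarrow> spine (\<Delta> j) (T j) \<or> \<Delta> j = [] \<or> (\<exists>\<rho>. \<Delta> j = [\<rho>] \<and> CF \<rho> (T j))"
  shows "CF (concat (map \<Delta> js) \<rightarrow>* Atom a) (map T js \<rightarrow>* Atom a)"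
proof -
  define P where "P j = spine (\<Delta> j) (T j)" for j
  define hs where "hs = filter P js"
  define ns where "ns = filter (\<lambda>j. \<not> P j) js"
  have "\<exists>\<Sigma> \<sigma>. (\<Sigma> \<rightarrow>* \<sigma> \<rightarrow> Atom a) \<sim> T j \<and> CF (\<Delta> j \<rightarrow>* Atom a) \<sigma>" if j: "j \<in> set hs" for j
  proof -
    obtain \<Sigma> q where "T j = \<Sigma> \<rightarrow>* Atom a" "q < length \<Sigma>" "CF (\<Delta> j \<rightarrow>* Atom a) (\<Sigma> ! q)"
      using j by (auto simp: hs_def P_def spine_def)
    then show ?thesis
      using arrows_move_last by metis
  qed
  then obtain \<Sigma> \<sigma> where sim: "\<And>j. j \<in> set hs \<Longrightarrow> (\<Sigma> j \<rightarrow>* \<sigma> j \<rightarrow> Atom a) \<sim> T j"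
    and CF: "\<And>j. j \<in> set hs \<Longrightarrow> CF (\<Delta> j \<rightarrow>* Atom a) (\<sigma> j)"
    by metis
  have "CF (concat (map (\<lambda>i. \<Delta> (hs ! i)) [0..<length hs]) \<rightarrow>* Atom a)
      (map (\<lambda>i. \<Sigma> (hs ! i) \<rightarrow>* \<sigma> (hs ! i) \<rightarrow> Atom a) [0..<length hs] \<rightarrow>* Atom a)"
    by (intro CF_D CF) simp
  then have "CF (concat (map \<Delta> hs) \<rightarrow>* Atom a) (map (\<lambda>j. \<Sigma> j \<rightarrow>* \<sigma> j \<rightarrow> Atom a) hs \<rightarrow>* Atom a)"
    unfolding map_comp_nth map_comp_nth[of "\<lambda>j. \<Sigma> j \<rightarrow>* \<sigma> j \<rightarrow> Atom a"] .
  then have "CF (concat (map \<Delta> hs) \<rightarrow>* Atom a) (map T hs \<rightarrow>* Atom a)"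
    by (rule CF_sim[OF _ sim_refl sim_arrows]) (simp add: list_all2_conv_all_nth sim)
  then have "CF (concat (map \<Delta> ns) \<rightarrow>* concat (map \<Delta> hs) \<rightarrow>* Atom a)
      (map T ns \<rightarrow>* map T hs \<rightarrow>* Atom a)"
    by (rule CF_combine_nonhead[rotated]) (use assms(2) in \<open>auto simp: ns_def P_def\<close>)
  then have "CF ((concat (map \<Delta> ns @ map \<Delta> hs)) \<rightarrow>* Atom a) ((map T ns @ map T hs) \<rightarrow>* Atom a)"
    by simp
  moreover have "mset (concat (map \<Delta> ns @ map \<Delta> hs)) = mset (concat (map \<Delta> js))"
    unfolding ns_def hs_def by (rule mset_concat_filter)
  moreover have "mset (map T ns @ map T hs) = mset (map T js)"
    unfolding ns_def hs_def by (simp flip: image_mset_union)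
  ultimately show ?thesis
    using CF_sim arrows_mset_sim by blast
qed

lemma size_arrows_nth: "q < length \<Sigma> \<Longrightarrow> size (\<Sigma> ! q) < size (\<Sigma> \<rightarrow>* \<rho>)"
proof (induction \<Sigma> arbitrary: q)
  case (Cons \<sigma> \<Sigma>)
  then show ?case by (cases q) (auto simp: less_Suc_eq trans_less_add2)
qed simp

text \<open>Induction on the size of the target: the new retractions go into an argument of
  \<open>\<tau>\<close> or into an argument of such an argument. The blocks partition
  \<open>ids\<close>, so their sources recombine to the given one up to order.\<close>

lemma open_retraction_CF:
  "open_retraction E \<Delta> a xs ids x y C D \<tau> \<Longrightarrow> CF (map ((!) \<Delta>) ids \<rightarrow>* Atom a) \<tau>"
proof (induction "size \<tau>" arbitrary: E \<Delta> a xs ids x y C D \<tau> rule: less_induct)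
  case less
  interpret open_retraction E \<Delta> a xs ids x y C D \<tau>
    by (rule less.prems)
  obtain Ts Ds where \<tau>: "\<tau> = Ts \<rightarrow>* Atom a" and "applied_coder E \<Delta> a xs ids x C Ts Ds"
    using applied_coder_exists by blast
  then interpret A: applied_coder E \<Delta> a xs ids x C Ts Ds
    by simp
  have "CF (concat (map (\<lambda>j. map ((!) \<Delta>) (A.block j)) [0..<length Ts]) \<rightarrow>* Atom a)
      (map ((!) Ts) [0..<length Ts] \<rightarrow>* Atom a)"
  proof (rule CF_combine)
    fix j assume "j \<in> set [0..<length Ts]"
    then have j: "j < length Ts" by simp
    have size: "size (Ts ! j) < size \<tau>"
      unfolding \<tau> by (rule size_arrows_nth[OF j])
    from A.block_step[OF j] consider
      (spine) \<Sigma> q F y' C' D' where "Ts ! j = \<Sigma> \<rightarrow>* Atom a" "q < length \<Sigma>"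
        "open_retraction F \<Delta> a xs (A.block j) x y' C' D' (\<Sigma> ! q)"
    | (empty) "A.block j = []"
    | (single) i \<Sigma> b F xs' x' y' C' D' where "A.block j = [i]" "\<Delta> ! i = \<Sigma> \<rightarrow>* Atom b"
        "open_retraction F \<Sigma> b xs' [0..<length \<Sigma>] x' y' C' D' (Ts ! j)"
      by blast
    then show "(\<exists>\<Sigma> q. Ts ! j = \<Sigma> \<rightarrow>* Atom a \<and> q < length \<Sigma> \<and>
          CF (map ((!) \<Delta>) (A.block j) \<rightarrow>* Atom a) (\<Sigma> ! q)) \<or>
        map ((!) \<Delta>) (A.block j) = [] \<or>
        (\<exists>\<rho>. map ((!) \<Delta>) (A.block j) = [\<rho>] \<and> CF \<rho> (Ts ! j))"
    proof cases
      case spine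
      have "size (\<Sigma> ! q) < size \<tau>"
        using size_arrows_nth[OF spine(2), of "Atom a"] size spine(1) by simp
      from less.hyps[OF this spine(3)] spine show ?thesis by blast
    next
      case single
      \<comment> \<open>Every position of \<open>\<Sigma>\<close> is of interest here, so the source
        type is the whole of \<open>\<Delta> ! i\<close>.\<close>
      from less.hyps[OF size single(3)] have "CF (\<Delta> ! i) (Ts ! j)"
        by (simp add: single(2) map_nth)
      then show ?thesis using single(1) by simp
    qed simp
  qed
  moreover have "mset (concat (map A.block [0..<length Ts])) = mset ids"
    unfolding A.block_def
    by (rule mset_concat_blocks)
      (use A.block_exists A.block_unique in \<open>force simp: A.block_def\<close>)+
  then have "image_mset ((!) \<Delta>) (mset (concat (map A.block [0..<length Ts]))) = mset (map ((!) \<Delta>) ids)"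
    by simp
  then have "mset (concat (map (\<lambda>j. map ((!) \<Delta>) (A.block j)) [0..<length Ts])) = mset (map ((!) \<Delta>) ids)"
    by (simp add: map_concat comp_def flip: mset_map)
  ultimately show ?case
    unfolding \<tau> map_nth using CF_sim arrows_mset_sim sim_refl by blast
qed

theorem theorem3p5:
  fixes \<rho> \<tau> :: stype
  assumes "\<rho> \<unlhd>\<^sup>1 \<tau>"
  shows "CF \<rho> \<tau>"
proof -
  obtain E C D where "coder_decoder E C D \<rho> \<tau>" and affine: "affine_trm C" "affine_trm D"
    using assms unfolding affine_retract_def by blast
  then have C: "\<rho> # E \<turnstile> C \<Colon> \<tau>" and D: "E \<turnstile> D \<Colon> \<tau> \<rightarrow> \<rho>"
    and DC: "\<rho> # E \<turnstile> App (lift_trm D 0) C =\<^sub>\<beta>\<^sub>\<eta> Var 0 \<Colon> \<rho>"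
    by (auto simp: coder_decoder_def)
  obtain \<Delta> a where \<rho>: "\<rho> = \<Delta> \<rightarrow>* Atom a"
    using stype_arrows_Atom by blast
  \<comment> \<open>\<open>x\<close> and \<open>E\<close> occupy the indices below \<open>y\<close>.
    The variable \<open>y\<close> for the code and the arguments \<open>xs\<close> come after them,
    so \<open>C\<close> and the decoder lifted past \<open>x\<close> keep their indices.\<close>
  define y where "y = Suc (length E)"
  define xs where "xs = [Suc y..<Suc y + length \<Delta>]"
  define F where "F = (\<rho> # E) @ \<tau> # \<Delta>"
  define D' where "D' = Apps (App (lift_trm D 0) (Var y)) (map Var xs)"
  have D_lift: "\<rho> # E \<turnstile> lift_trm D 0 \<Colon> \<tau> \<rightarrow> \<rho>"
    using typing_lift[of "[]" E D _ \<rho>] D by simp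
  have fresh: "occurrences k (lift_trm D 0) = 0" "occurrences k C = 0" if "y \<le> k" for k
    using that occurrences_fresh[OF D_lift] occurrences_fresh[OF C] by (auto simp: y_def)
  have occ: "occurrences k D' = occurrences k (lift_trm D 0) + (if k = y \<or> k \<in> set xs then 1 else 0)" for k
  proof -
    have "distinct xs \<Longrightarrow> (\<Sum>N\<leftarrow>map Var xs. occurrences k N) = (if k \<in> set xs then 1 else 0)"
      by (induction xs) auto
    then show ?thesis by (auto simp: D'_def xs_def simp del: upt_Suc)
  qed
  \<comment> \<open>Initially all arguments are to be decoded, and \<open>x\<close> has index
    0.\<close>
  have "open_retraction F \<Delta> a xs [0..<length \<Delta>] 0 y C D' \<tau>"
  proof unfold_locales
    show "0 < length F" "F ! 0 = \<Delta> \<rightarrow>* Atom a"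
      by (auto simp: F_def \<rho>)
    show "F ! y = \<tau>"
      by (simp add: F_def y_def nth_append)
    show "length xs = length \<Delta>" "distinct [0..<length \<Delta>]" "0 \<notin> set xs"
      by (auto simp: xs_def y_def simp del: upt_Suc)
    show xs_F: "xs ! i < length F" "F ! (xs ! i) = \<Delta> ! i" if "i < length \<Delta>" for i
      using that by (auto simp: xs_def F_def y_def nth_append simp del: upt_Suc)
    show "i < length \<Delta>" if "i \<in> set [0..<length \<Delta>]" for i
      using that by simp
    show "F \<turnstile> C \<Colon> \<tau>"
      unfolding F_def by (rule typing_append[OF C])
    have "list_all2 (typing F) (map Var xs) \<Delta>"
      using xs_F by (auto simp: list_all2_conv_all_nth xs_def simp del: upt_Suc intro!: typing_VarI)
    moreover have "F \<turnstile> App (lift_trm D 0) (Var y) \<Colon> \<rho>"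
      by (rule typing_App, unfold F_def, rule typing_append[OF D_lift], rule typing_VarI)
        (auto simp: y_def nth_append)
    ultimately show "F \<turnstile> D' \<Colon> Atom a"
      unfolding D'_def typing_Apps \<rho> by blast
    show "bound_at_most_once C" "bound_at_most_once D'" "occurrences 0 C \<le> 1"
      using affine by (auto simp: affine_trm_def D'_def)
    show "occurrences (xs ! i) C = 0" "occurrences (xs ! i) D' \<le> 1"
      if "i \<in> set [0..<length \<Delta>]" for i
      using that by (auto simp: xs_def fresh occ simp del: upt_Suc)
    show "occurrences 0 D' = 0"
      by (simp add: occ occurrences_lift y_def xs_def del: upt_Suc)
    show "occurrences y D' \<le> 1"
      by (simp add: occ fresh)
    show "sem D' (\<nu>(y := sem C \<nu>)) = of_bool (\<phi> (map \<nu> xs))"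
      if "valuation F \<nu>" "\<nu> 0 = curry_code \<Delta> \<phi>" for \<nu> \<phi>
    proof -
      have "valuation (\<rho> # E) \<nu>"
        using that(1) unfolding F_def by (rule valuation_append)
      \<comment> \<open>The \<beta>\<eta>-equation enters only through its meaning: the decoder
        applied to the coder denotes the value of \<open>x\<close>. Updating \<open>y\<close>
        disturbs neither the decoder nor the variables \<open>xs\<close>.\<close>
      from sem_beta_eta_eq[OF DC this] have "app_code (sem (lift_trm D 0) \<nu>) (sem C \<nu>) = curry_code \<Delta> \<phi>"
        using that(2) by simp
      moreover have "map (\<lambda>N. sem N (\<nu>(y := sem C \<nu>))) (map Var xs) = map \<nu> xs"
        by (auto simp: xs_def simp del: upt_Suc)
      moreover have "list_all2 (\<lambda>u \<sigma>. u \<in> carrier \<sigma>) (map \<nu> xs) \<Delta>"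
        using that(1) xs_F unfolding list_all2_conv_all_nth valuation_def
        by (metis length_map \<open>length xs = length \<Delta>\<close> nth_map)
      ultimately show ?thesis
        by (simp add: D'_def fresh del: map_map)
    qed
  qed
  from open_retraction_CF[OF this] show ?thesis
    by (simp add: \<rho> map_nth)
qed

end
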